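(* Let $M,K,H,I,J$ be positive integers, let $\mathbb{X}\subseteq\mathbb{R}^K$ be closed, let $\Xi\subseteq\mathbb{R}^M$, and let $\ell_j:\mathbb{R}^K\times\mathbb{R}^M\to\mathbb{R}$, $j\in[J]$, be measurable functions with $\ell(\bm{x},\bm{\xi}):=\max_{j\in[J]}\ell_j(\bm{x},\bm{\xi})$. Let $\hat{\bm{\xi}}^{(i)}_h\in\Xi$ ($h\in[H]$, $i\in[I]$) be given points, let $t^{(I)}_h\in[0,1]$ ($h\in[H]$) be weights with $\sum_{h=1}^H t^{(I)}_h=1$, and let $$\hat{\mathbb{P}}_{HI}:=\sum_{h=1}^{H}\frac{t^{(I)}_h}{I}\sum_{i=1}^{I}\delta_{\hat{\bm{\xi}}^{(i)}_h}.$$ Assume that (i) $\Xi$ is convex and closed; (ii) for every fixed $\bm{x}\in\mathbb{X}$ and every $j\in[J]$, the function $-\ell_j(\bm{x},\cdot)$ is proper, convex and lower semi-continuous in $\bm{\xi}$, and $\ell_j(\bm{x},\cdot)$ is not identically $-\infty$ on $\Xi$. Then for any $\epsilon\ge 0$ and every fixed $\bm{x}\in\mathbb{X}$, the worst-case expectation $$\sup_{\mathbb{Q}\in\mathbb{B}_\epsilon(\hat{\mathbb{P}}_{HI})}\mathbb{E}^{\mathbb{Q}}[\ell(\bm{x},\bm{\xi})]$$ equals the optimal objective value of the convex program $$\begin{aligned} \inf_{\lambda,\,s_{hi},\,\bm{z}_{hij},\,\bm{\nu}_{hij}}\quad & \lambda\epsilon+\sum_{h=1}^{H}\sum_{i=1}^{I}\frac{t^{(I)}_h}{I}\,s_{hi}\\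 \text{s.t.}\quad & [-\ell_j]^{*}(\bm{z}_{hij}-\bm{\nu}_{hij})+\sigma_{\Xi}(\bm{\nu}_{hij})-\langle\bm{z}_{hij},\hat{\bm{\xi}}^{(i)}_h\rangle\le s_{hi},\quad\forall h\in[H],\,i\in[I],\,j\in[J],\\ & \|\bm{z}_{hij}\|_{*}\le\lambda,\quad\forall h\in[H],\,i\in[I],\,j\in[J], \end{aligned}$$ where $\lambda,s_{hi}\in\mathbb{R}$ and $\bm{z}_{hij},\bm{\nu}_{hij}\in\mathbb{R}^M$, and $[-\ell_j]^*$ denotes the conjugate of $\bm{\xi}\mapsto-\ell_j(\bm{x},\bm{\xi})$ for the fixed $\bm{x}$.
   Context: Notation: $[N]=\{1,\dots,N\}$; $\langle\bm{u},\bm{v}\rangle=\bm{u}^{\mathsf T}\bm{v}$; $\delta_{\bm{\xi}_0}$ is the Dirac point mass at $\bm{\xi}_0$. $\|\cdot\|$ is an arbitrary fixed norm on $\mathbb{R}^M$ and $\|\bm{v}\|_*:=\sup_{\|\bm{u}\|\le1}\langle\bm{v},\bm{u}\rangle$ is its dual norm. The conjugate of a function $f$ is $f^*(\bm{v}):=\sup_{\bm{u}\in\mathrm{dom}\, f}\langle\bm{v},\bm{u}\rangle-f(\bm{u})$. The support function of $\Xi$ is $\sigma_\Xi(\bm{u}):=\sup_{\bm{\xi}\in\Xi}\langle\bm{u},\bm{\xi}\rangle$. $\mathcal{M}(\Xi)$ is the set of all probability distributions $\mathbb{Q}$ on $\Xi$ with $\mathbb{E}^{\mathbb{Q}}[\|\bm{\xi}\|]=\int_\Xi\|\bm{\xi}\|\,\mathbb{Q}(d\bm{\xi})<\infty$.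 The Wasserstein distance is $$d_W(\hat{\mathbb{P}},\mathbb{Q})=\inf_{\Pi}\int_{\Xi^2}\|\bm{\xi}-\bm{\xi}'\|\,\Pi(d\bm{\xi},d\bm{\xi}'),$$ the infimum being over joint distributions $\Pi$ of $\bm{\xi}$ and $\bm{\xi}'$ with marginals $\mathbb{Q}$ and $\hat{\mathbb{P}}$ respectively. The ambiguity set is $\mathbb{B}_\epsilon(\hat{\mathbb{P}}_{HI})=\{\mathbb{Q}\in\mathcal{M}(\Xi): d_W(\hat{\mathbb{P}}_{HI},\mathbb{Q})\le\epsilon\}$. Standing assumption: $\ell(\bm{x},\bm{\xi})$ is lower semi-continuous in $\bm{x}$ for every fixed $\bm{\xi}\in\Xi$ and upper semi-continuous in $\bm{\xi}$ for every fixed $\bm{x}\in\mathbb{X}$. *)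

theory Defs
  imports "HOL-Probability.Probability"
begin

definition is_norm :: "('a::real_vector \<Rightarrow> real) \<Rightarrow> bool" where
  "is_norm nrm \<longleftrightarrow>
     (\<forall>v. 0 \<le> nrm v) \<and> (\<forall>v. nrm v = 0 \<longleftrightarrow> v = 0) \<and>
     (\<forall>c v. nrm (c *\<^sub>R v) = \<bar>c\<bar> * nrm v) \<and>
     (\<forall>u v. nrm (u + v) \<le> nrm u + nrm v)"

text \<open>On a Euclidean space every norm dominates a positive multiple of the Euclidean one, so the
  real-valued supremum below is that of a nonempty bounded set.\<close>

definition dual_norm :: "('a::euclidean_space \<Rightarrow> real) \<Rightarrow> 'a \<Rightarrow> real" where
  "dual_norm nrm v = (SUP u\<in>{u. nrm u \<le> 1}. v \<bullet> u)"

definition eff_dom :: "('a \<Rightarrow> ereal) \<Rightarrow> 'a set" where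
  "eff_dom f = {u. f u < \<infinity>}"

definition proper_fun :: "('a \<Rightarrow> ereal) \<Rightarrow> bool" where
  "proper_fun f \<longleftrightarrow> (\<forall>u. f u \<noteq> -\<infinity>) \<and> eff_dom f \<noteq> {}"

definition conjugate :: "('a::real_inner \<Rightarrow> ereal) \<Rightarrow> 'a \<Rightarrow> ereal" where
  "conjugate f v = (SUP u\<in>eff_dom f. ereal (v \<bullet> u) - f u)"

definition support_fun :: "'a::real_inner set \<Rightarrow> 'a \<Rightarrow> ereal" where
  "support_fun \<Xi> u = (SUP \<xi>\<in>\<Xi>. ereal (u \<bullet> \<xi>))"

definition lsc_on :: "'a::topological_space set \<Rightarrow> ('a \<Rightarrow> real) \<Rightarrow> bool" where
  "lsc_on S f \<longleftrightarrow> (\<forall>x\<in>S. \<forall>y<f x. \<forall>\<^sub>F x' in at x within S. y < f x')"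

definition usc_on :: "'a::topological_space set \<Rightarrow> ('a \<Rightarrow> real) \<Rightarrow> bool" where
  "usc_on S f \<longleftrightarrow> (\<forall>x\<in>S. \<forall>y>f x. \<forall>\<^sub>F x' in at x within S. f x' < y)"

text \<open>A distribution on \<open>\<Xi>\<close> is a probability measure whose underlying space is
  \<open>\<Xi>\<close> itself, with the trace of the Borel sigma-algebra.\<close>

abbreviation borel_on :: "'a::topological_space set \<Rightarrow> 'a measure" where
  "borel_on \<Xi> \<equiv> restrict_space borel \<Xi>"

definition prob_dists :: "('a::euclidean_space \<Rightarrow> real) \<Rightarrow> 'a set \<Rightarrow> 'a measure set" where
  "prob_dists nrm \<Xi> =
     {Q \<in> space (prob_algebra (borel_on \<Xi>)). (\<integral>\<^sup>+\<xi>. ennreal (nrm \<xi>) \<partial>Q) < \<infinity>}"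

definition couplings :: "'a::euclidean_space set \<Rightarrow> 'a measure \<Rightarrow> 'a measure \<Rightarrow> ('a \<times> 'a) measure set"
  where
  "couplings \<Xi> Q P =
     {\<gamma> \<in> space (prob_algebra (borel_on \<Xi> \<Otimes>\<^sub>M borel_on \<Xi>)).
        distr \<gamma> (borel_on \<Xi>) fst = Q \<and> distr \<gamma> (borel_on \<Xi>) snd = P}"

definition wasserstein ::
    "('a::euclidean_space \<Rightarrow> real) \<Rightarrow> 'a set \<Rightarrow> 'a measure \<Rightarrow> 'a measure \<Rightarrow> ennreal" where
  "wasserstein nrm \<Xi> P Q =
     (INF \<gamma>\<in>couplings \<Xi> Q P. \<integral>\<^sup>+(\<xi>, \<xi>'). ennreal (nrm (\<xi> - \<xi>')) \<partial>\<gamma>)"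

definition wasserstein_ball ::
    "('a::euclidean_space \<Rightarrow> real) \<Rightarrow> 'a set \<Rightarrow> real \<Rightarrow> 'a measure \<Rightarrow> 'a measure set" where
  "wasserstein_ball nrm \<Xi> \<epsilon> P = {Q \<in> prob_dists nrm \<Xi>. wasserstein nrm \<Xi> P Q \<le> ennreal \<epsilon>}"

text \<open>The Bochner integral assigns 0 to non-integrable functions. Under a distribution with
  finite first moment a concave function can have expectation \<open>-\<infinity>\<close> (its positive part
  is always integrable), so expectations are taken as extended reals.\<close>

definition expect :: "'a measure \<Rightarrow> ('a \<Rightarrow> real) \<Rightarrow> ereal" where
  "expect Q f =
     enn2ereal (\<integral>\<^sup>+\<xi>. ennreal (f \<xi>) \<partial>Q) - enn2ereal (\<integral>\<^sup>+\<xi>. ennreal (- f \<xi>) \<partial>Q)"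

definition weighted_empirical ::
    "'a::topological_space set \<Rightarrow> nat \<Rightarrow> nat \<Rightarrow> (nat \<Rightarrow> real) \<Rightarrow> (nat \<Rightarrow> nat \<Rightarrow> 'a) \<Rightarrow> 'a measure" where
  "weighted_empirical \<Xi> H I t \<xi>h =
     measure_of \<Xi> (sets (borel_on \<Xi>))
       (\<lambda>A. \<Sum>h=1..H. ennreal (t h / real I) *
              (\<Sum>i=1..I. emeasure (return (borel_on \<Xi>) (\<xi>h h i)) A))"

lemma sets_weighted_empirical [simp, measurable_cong]:
  "sets (weighted_empirical \<Xi> H I t \<xi>h) = sets (borel_on \<Xi>)"
  using sets.sets_measure_of_eq[of "borel_on \<Xi>"]
  by (simp add: weighted_empirical_def space_restrict_space)

lemma emeasure_weighted_empirical:
  assumes "A \<in> sets (borel_on \<Xi>)"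
  shows "emeasure (weighted_empirical \<Xi> H I t \<xi>h) A =
    (\<Sum>h=1..H. ennreal (t h / real I) * (\<Sum>i=1..I. emeasure (return (borel_on \<Xi>) (\<xi>h h i)) A))"
    (is "_ = ?\<mu> A")
proof (rule emeasure_measure_of[OF weighted_empirical_def])
  show "sets (borel_on \<Xi>) \<subseteq> Pow \<Xi>"
    using sets.sets_into_space[of _ "borel_on \<Xi>"] by (auto simp: space_restrict_space)
  show "A \<in> sets (weighted_empirical \<Xi> H I t \<xi>h)" using assms by simp
  show "positive (sets (weighted_empirical \<Xi> H I t \<xi>h)) ?\<mu>" by (simp add: positive_def)
  show "countably_additive (sets (weighted_empirical \<Xi> H I t \<xi>h)) ?\<mu>"
  proof (rule countably_additiveI)
    fix B :: "nat \<Rightarrow> 'a set"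
    assume B: "range B \<subseteq> sets (weighted_empirical \<Xi> H I t \<xi>h)" "disjoint_family B"
    have "(\<Sum>n. ?\<mu> (B n)) =
        (\<Sum>h=1..H. ennreal (t h / real I) *
          (\<Sum>i=1..I. \<Sum>n. emeasure (return (borel_on \<Xi>) (\<xi>h h i)) (B n)))"
      by (simp add: suminf_sum)
    also have "\<dots> = ?\<mu> (\<Union>n. B n)"
      using B by (intro sum.cong refl arg_cong2[where f="(*)"] suminf_emeasure) simp_all
    finally show "(\<Sum>n. ?\<mu> (B n)) = ?\<mu> (\<Union>n. B n)" .
  qed
qed

lemma weighted_empirical_prob:
  assumes "0 < I" "\<And>h i. h \<in> {1..H} \<Longrightarrow> i \<in> {1..I} \<Longrightarrow> \<xi>h h i \<in> \<Xi>"
    and "\<And>h. h \<in> {1..H} \<Longrightarrow> 0 \<le> t h" "(\<Sum>h=1..H. t h) = 1"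
  shows "weighted_empirical \<Xi> H I t \<xi>h \<in> space (prob_algebra (borel_on \<Xi>))"
proof -
  let ?P = "weighted_empirical \<Xi> H I t \<xi>h"
  have sp: "space ?P = \<Xi>"
    using sets_eq_imp_space_eq[of ?P "borel_on \<Xi>"] by (simp add: space_restrict_space)
  have top: "\<Xi> \<in> sets (borel_on \<Xi>)"
    using sets.top[of "borel_on \<Xi>"] by (simp add: space_restrict_space)
  have "emeasure ?P \<Xi> = (\<Sum>h=1..H. ennreal (t h / real I) * (\<Sum>i=1..I. 1))"
    unfolding emeasure_weighted_empirical[OF top]
    using assms(2) top by (intro sum.cong) (auto simp: indicator_def)
  also have "\<dots> = (\<Sum>h=1..H. ennreal (t h))"
    using assms(1,3)
    by (intro sum.cong)
       (auto simp: ennreal_of_nat_eq_real_of_nat simp flip: ennreal_mult)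
  also have "\<dots> = ennreal (\<Sum>h=1..H. t h)" using assms(3) by (intro sum_ennreal)
  also have "\<dots> = 1" using assms(4) by simp
  finally have "prob_space ?P" by (intro prob_spaceI) (simp add: sp)
  then show ?thesis by (simp add: space_prob_algebra)
qed

text \<open>The functions \<open>f j\<close> are the \<open>-\<ell>\<^sub>j(x, \<cdot>)\<close>. Only the values of
  \<open>s\<close>, \<open>z\<close>, \<open>\<nu>\<close> at indices in range are constrained.\<close>

definition program_feasible ::
    "('a::euclidean_space \<Rightarrow> real) \<Rightarrow> 'a set \<Rightarrow> nat \<Rightarrow> nat \<Rightarrow> nat \<Rightarrow> (nat \<Rightarrow> nat \<Rightarrow> 'a) \<Rightarrow> (nat \<Rightarrow> 'a \<Rightarrow> ereal) \<Rightarrow>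
     (real \<times> (nat \<Rightarrow> nat \<Rightarrow> real) \<times> (nat \<Rightarrow> nat \<Rightarrow> nat \<Rightarrow> 'a) \<times> (nat \<Rightarrow> nat \<Rightarrow> nat \<Rightarrow> 'a)) set" where
  "program_feasible nrm \<Xi> H I J \<xi>h f =
     {(lam, s, z, \<nu>).
        (\<forall>h\<in>{1..H}. \<forall>i\<in>{1..I}. \<forall>j\<in>{1..J}.
           conjugate (f j) (z h i j - \<nu> h i j) + support_fun \<Xi> (\<nu> h i j)
             - ereal (z h i j \<bullet> \<xi>h h i) \<le> ereal (s h i)) \<and>
        (\<forall>h\<in>{1..H}. \<forall>i\<in>{1..I}. \<forall>j\<in>{1..J}. dual_norm nrm (z h i j) \<le> lam)}"

lemma program_constraint_iff:
  fixes g :: "'a::euclidean_space \<Rightarrow> real"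
  assumes "\<Xi> \<noteq> {}"
  shows "conjugate (\<lambda>u. ereal (g u)) (z - \<nu>) + support_fun \<Xi> \<nu> - ereal (z \<bullet> p) \<le> ereal s
    \<longleftrightarrow> (\<forall>u. \<forall>\<xi>\<in>\<Xi>. (z - \<nu>) \<bullet> u - g u + \<nu> \<bullet> \<xi> - z \<bullet> p \<le> s)"
    (is "?L \<longleftrightarrow> ?R")
proof -
  let ?c = "\<lambda>u. ereal ((z - \<nu>) \<bullet> u - g u)"
  have conj: "conjugate (\<lambda>u. ereal (g u)) (z - \<nu>) = (SUP u. ?c u)"
    by (simp add: conjugate_def eff_dom_def)
  obtain \<xi>0 where "\<xi>0 \<in> \<Xi>" using assms by blast
  then have "ereal (\<nu> \<bullet> \<xi>0) \<le> support_fun \<Xi> \<nu>"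
    unfolding support_fun_def by (rule SUP_upper)
  then have supp: "support_fun \<Xi> \<nu> \<noteq> -\<infinity>" by auto
  have "?L \<longleftrightarrow> (SUP u. ?c u) + support_fun \<Xi> \<nu> \<le> ereal (s + z \<bullet> p)"
    by (simp add: conj ereal_minus_le)
  also have "(SUP u. ?c u) + support_fun \<Xi> \<nu> = (SUP u. ?c u + support_fun \<Xi> \<nu>)"
    using supp by (simp add: SUP_ereal_add_left)
  also have "\<dots> = (SUP u. SUP \<xi>\<in>\<Xi>. ?c u + ereal (\<nu> \<bullet> \<xi>))"
    unfolding support_fun_def using assms
    by (intro SUP_cong refl SUP_ereal_add_right[symmetric]) auto
  also have "\<dots> \<le> ereal (s + z \<bullet> p) \<longleftrightarrow> ?R"
    by (auto simp: SUP_le_iff algebra_simps)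
  finally show ?thesis .
qed

lemma is_norm_dominates:
  fixes nrm :: "'a::euclidean_space \<Rightarrow> real"
  assumes "is_norm nrm"
  obtains c where "0 < c" "\<And>u. c * norm u \<le> nrm u"
proof -
  have nn: "0 \<le> nrm v" and zero: "nrm v = 0 \<longleftrightarrow> v = 0" and sc: "nrm (a *\<^sub>R v) = \<bar>a\<bar> * nrm v"
    and tri: "nrm (u + v) \<le> nrm u + nrm v" for a u v
    using assms by (auto simp: is_norm_def)
  have nrm0: "nrm 0 = 0" using zero[of 0] by simp
  define C where "C = (\<Sum>b\<in>Basis. nrm (b::'a))"
  have sum_le: "nrm (\<Sum>i\<in>A. h i) \<le> (\<Sum>i\<in>A. nrm (h i))" if "finite A" for A and h :: "'a \<Rightarrow> 'a"
    using that by (induction A) (auto simp: nrm0 intro: order_trans[OF tri])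
  have up: "nrm u \<le> C * norm u" for u
  proof -
    have "nrm u = nrm (\<Sum>b\<in>Basis. (u \<bullet> b) *\<^sub>R b)" by (simp add: euclidean_representation)
    also have "\<dots> \<le> (\<Sum>b\<in>Basis. nrm ((u \<bullet> b) *\<^sub>R b))" by (rule sum_le) simp
    also have "\<dots> \<le> (\<Sum>b\<in>Basis. norm u * nrm b)"
      by (intro sum_mono) (auto simp: sc nn Basis_le_norm intro!: mult_right_mono)
    finally show ?thesis by (simp add: C_def sum_distrib_left mult.commute)
  qed
  have neg: "nrm (- v) = nrm v" for v using sc[of "-1" v] by simp
  have "C-lipschitz_on UNIV nrm"
  proof (rule lipschitz_onI)
    show "0 \<le> C" by (simp add: C_def sum_nonneg nn)
    fix u v
    have "nrm u \<le> nrm (u - v) + nrm v" "nrm v \<le> nrm (u - v) + nrm u"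
      using tri[of "u - v" v] tri[of "v - u" u] neg[of "u - v"] by simp_all
    then show "dist (nrm u) (nrm v) \<le> C * dist u v"
      using up[of "u - v"] by (simp add: dist_real_def dist_norm)
  qed
  then have cont: "continuous_on (sphere 0 1) nrm"
    using lipschitz_on_continuous_on continuous_on_subset by blast
  have "sphere (0::'a) 1 \<noteq> {}" by simp
  then obtain w where w: "w \<in> sphere 0 1" "\<And>u. u \<in> sphere 0 1 \<Longrightarrow> nrm w \<le> nrm u"
    using continuous_attains_inf[OF compact_sphere _ cont] by blast
  show thesis
  proof
    show "0 < nrm w" using w(1) nn[of w] zero[of w] by force
    fix u
    show "nrm w * norm u \<le> nrm u"
    proof (cases "u = 0")
      case False
      then have "nrm w \<le> nrm ((1 / norm u) *\<^sub>R u)" by (intro w(2)) simp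
      then show ?thesis using False by (simp add: sc field_simps)
    qed (simp add: nn)
  qed
qed

lemma dual_norm_le_iff:
  assumes "is_norm nrm"
  shows "dual_norm nrm v \<le> c \<longleftrightarrow> (\<forall>u. nrm u \<le> 1 \<longrightarrow> v \<bullet> u \<le> c)"
proof -
  obtain d where d: "0 < d" "\<And>u. d * norm u \<le> nrm u"
    using is_norm_dominates[OF assms] by blast
  have "v \<bullet> u \<le> norm v * (1 / d)" if "nrm u \<le> 1" for u
  proof -
    have "norm u \<le> 1 / d" using d(1) order_trans[OF d(2) that] by (simp add: field_simps)
    then show ?thesis
      using norm_cauchy_schwarz[of v u] by (meson mult_left_mono norm_ge_zero order_trans)
  qed
  then have bdd: "bdd_above ((\<lambda>u. v \<bullet> u) ` {u. nrm u \<le> 1})"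
    by (intro bdd_aboveI2) auto
  have "nrm 0 \<le> 1" using assms unfolding is_norm_def by (metis zero_le_one)
  then have "{u. nrm u \<le> 1} \<noteq> {}" by auto
  then show ?thesis unfolding dual_norm_def by (subst cSUP_le_iff[OF _ bdd]) auto
qed

text \<open>The objective of the program is linear; its feasible set is convex.\<close>

lemma program_feasible_convex:
  assumes "is_norm nrm" "\<Xi> \<noteq> {}" "0 \<le> a" "0 \<le> b" "a + b = 1"
    and "(lam1, s1, z1, \<nu>1) \<in> program_feasible nrm \<Xi> H I J \<xi>h (\<lambda>j u. ereal (g j u))"
    and "(lam2, s2, z2, \<nu>2) \<in> program_feasible nrm \<Xi> H I J \<xi>h (\<lambda>j u. ereal (g j u))"
  shows "(a * lam1 + b * lam2, \<lambda>h i. a * s1 h i + b * s2 h i,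
      \<lambda>h i j. a *\<^sub>R z1 h i j + b *\<^sub>R z2 h i j, \<lambda>h i j. a *\<^sub>R \<nu>1 h i j + b *\<^sub>R \<nu>2 h i j)
    \<in> program_feasible nrm \<Xi> H I J \<xi>h (\<lambda>j u. ereal (g j u))"
proof -
  have comb: "a * p + b * q \<le> a * p' + b * q'" if "p \<le> p'" "q \<le> q'" for p q p' q' :: real
    using that assms(3,4) by (intro add_mono mult_left_mono)
  have split_g: "y = a * y + b * y" for y :: real
    using assms(5) by (metis distrib_right mult_1)
  have "((a *\<^sub>R z + b *\<^sub>R z') - (a *\<^sub>R n + b *\<^sub>R n')) \<bullet> u - g j u + (a *\<^sub>R n + b *\<^sub>R n') \<bullet> \<xi>
      - (a *\<^sub>R z + b *\<^sub>R z') \<bullet> p \<le> a * s + b * s'"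
    if "(z - n) \<bullet> u - g j u + n \<bullet> \<xi> - z \<bullet> p \<le> s" "(z' - n') \<bullet> u - g j u + n' \<bullet> \<xi> - z' \<bullet> p \<le> s'"
    for z z' n n' u \<xi> p s s' j
    using comb[OF that] split_g[of "g j u"]
    by (simp add: inner_add_left inner_diff_left algebra_simps)
  moreover have "(a *\<^sub>R z + b *\<^sub>R z') \<bullet> u \<le> a * l + b * l'" if "z \<bullet> u \<le> l" "z' \<bullet> u \<le> l'"
    for z z' u :: 'a and l l'
    using comb[OF that] by (simp add: inner_add_left)
  ultimately show ?thesis
    using assms(6,7)
    unfolding program_feasible_def program_constraint_iff[OF assms(2)] dual_norm_le_iff[OF assms(1)]
    by simp
qed

end

theory Submission
  imports Defs
begin

text \<open>
Write \<open>f = loss x\<close>, and let \<open>p\<close> range over the sample points, with weights \<open>w\<close>. Up to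
the conjugate calculus, the program asks for the infimum of the values \<open>lam * \<epsilon> + \<Sum> w * s\<close> such that
\<open>f \<xi> \<le> s + lam * nrm (\<xi> - p)\<close> for all \<open>\<xi> \<in> \<Xi>\<close> and all \<open>p\<close>, each with
its own \<open>s\<close>. Two facts give the equality.

First, the constraints of the program express exactly this inequality. If \<open>z\<close> and
\<open>\<nu>\<close> are feasible, taking the same point in the conjugate and in the support function
gives the inequality for each piece \<open>lossj j x\<close>. Conversely, \<open>dual_certificate\<close> produces
\<open>z\<close> and \<open>\<nu>\<close>. Duality gaps and attainment are no issue because the pieces are
concave and finite on the whole space, so that \<open>affine_sandwich\<close> applies.

Second, the worst-case expectation is the value of a transport problem, and minimising
\<open>lam * \<epsilon> + \<Sum> w * s\<close> under this inequality is its Lagrangian dual. Integrating the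
inequality against a nearly optimal coupling gives \<open>weak_duality\<close>. For the other direction it
is enough to use finitely supported plans: they form a convex family with a linear cost and a
linear value, so for a positive radius a separating line in the plane of costs and values yields
the multiplier \<open>lam\<close> (\<open>multiplier_exists\<close>), and the penalised problem decouples over the
sample points (\<open>sum_SUP_le_by_selection\<close>). At radius 0 the Slater point is lost, and the
supergradients of the pieces at the sample points (\<open>concave_Lipschitz_above\<close>) provide a
\<open>lam\<close> that is large enough; \<open>dual_potential_exists\<close> joins the two cases. Thus the program
has a feasible point of value at most the worst-case expectation whenever the latter is finite,
and if it is infinite there is nothing to prove.
\<close>

section \<open>Separation of a convex from a concave function\<close>

text \<open>A hyperplane separating the strict epigraph of \<open>h\<close> from the hypograph of \<open>k\<close> cannot
be vertical, because \<open>h\<close> is finite on the whole space; so it is the graph of an affine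
function. Finiteness of \<open>h\<close> thus replaces a constraint qualification. With \<open>C\<close> a single
point and \<open>k\<close> the value of \<open>h\<close> there, the lemma yields a subgradient.\<close>

lemma affine_sandwich:
  fixes h k :: "'a::euclidean_space \<Rightarrow> real"
  assumes h: "convex_on UNIV h" and k: "concave_on C k" and ne: "C \<noteq> {}"
    and le: "\<And>u. u \<in> C \<Longrightarrow> k u \<le> h u"
  obtains a b where "\<And>u. a \<bullet> u + b \<le> h u" "\<And>u. u \<in> C \<Longrightarrow> k u \<le> a \<bullet> u + b"
proof -
  let ?A = "{(u, r). u \<in> C \<and> r \<le> k u}" and ?B = "{(u, r). h u < r}"
  have cC: "convex C" and kc: "\<And>u v p q. u \<in> C \<Longrightarrow> v \<in> C \<Longrightarrow> 0 \<le> p \<Longrightarrow> 0 \<le> q \<Longrightarrow> p + q = 1 \<Longrightarrow>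
      p * k u + q * k v \<le> k (p *\<^sub>R u + q *\<^sub>R v)"
    using k by (auto simp: concave_on_iff)
  have hc: "\<And>u v p q. 0 \<le> p \<Longrightarrow> 0 \<le> q \<Longrightarrow> p + q = 1 \<Longrightarrow>
      h (p *\<^sub>R u + q *\<^sub>R v) \<le> p * h u + q * h v"
    using h by (auto simp: convex_on_def)
  have "convex ?A"
  proof (rule convexI, clarsimp)
    fix u r v s p q assume *: "u \<in> C" "v \<in> C" "r \<le> k u" "s \<le> k v" "0 \<le> p" "0 \<le> q" "p + q = (1::real)"
    have "p * r + q * s \<le> p * k u + q * k v" using * by (intro add_mono mult_left_mono)
    then show "p *\<^sub>R u + q *\<^sub>R v \<in> C \<and> p * r + q * s \<le> k (p *\<^sub>R u + q *\<^sub>R v)"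
      using kc[of u v p q] * convexD[OF cC] by force
  qed
  moreover have "convex ?B"
  proof (rule convexI, clarsimp)
    fix u r v s p q assume *: "h u < r" "h v < s" "0 \<le> p" "0 \<le> q" "p + q = (1::real)"
    have "p * h u + q * h v < p * r + q * s"
    proof (cases "p = 0")
      case False
      then have "p * h u < p * r" using * by simp
      moreover have "q * h v \<le> q * s" using * by (intro mult_left_mono) auto
      ultimately show ?thesis by simp
    qed (use * in auto)
    then show "h (p *\<^sub>R u + q *\<^sub>R v) < p * r + q * s" using hc[of p q u v] * by linarith
  qed
  moreover have "?A \<noteq> {}" "?B \<noteq> {}" using ne by (auto intro: lt_ex gt_ex)
  moreover have "?A \<inter> ?B = {}" using le by force
  ultimately obtain nt \<beta> where nt: "nt \<noteq> 0" "\<forall>x\<in>?A. nt \<bullet> x \<le> \<beta>" "\<forall>x\<in>?B. nt \<bullet> x \<ge> \<beta>"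
    using separating_hyperplane_sets by meson
  obtain n \<tau> where [simp]: "nt = (n, \<tau>)" by (cases nt)
  have A: "n \<bullet> u + \<tau> * r \<le> \<beta>" if "u \<in> C" "r \<le> k u" for u r using nt(2) that by auto
  have B: "\<beta> \<le> n \<bullet> u + \<tau> * r" if "h u < r" for u r using nt(3) that by auto
  have "\<tau> \<ge> 0"
  proof (rule ccontr)
    assume neg: "\<not> \<tau> \<ge> 0"
    define r where "r = max (h 0 + 1) ((\<beta> - 1) / \<tau>)"
    have "\<tau> * r \<le> \<tau> * ((\<beta> - 1) / \<tau>)" using neg by (intro mult_left_mono_neg) (auto simp: r_def)
    moreover have "\<tau> * ((\<beta> - 1) / \<tau>) = \<beta> - 1" using neg by simp
    moreover have "h 0 < r" by (simp add: r_def)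
    ultimately show False using B[of 0 r] by simp
  qed
  moreover have "\<tau> \<noteq> 0"
  proof
    assume 0: "\<tau> = 0"
    then have n: "n \<noteq> 0" using nt(1) by (auto simp: zero_prod_def)
    have "\<beta> \<le> n \<bullet> (((\<beta> - 1) / (n \<bullet> n)) *\<^sub>R n)"
      using B[of "((\<beta> - 1) / (n \<bullet> n)) *\<^sub>R n" "h (((\<beta> - 1) / (n \<bullet> n)) *\<^sub>R n) + 1"]
      unfolding 0 by simp
    then show False using n by simp
  qed
  ultimately have t: "\<tau> > 0" by simp
  show thesis
  proof
    fix u
    have *: "((- 1 / \<tau>) *\<^sub>R n) \<bullet> u + \<beta> / \<tau> = (\<beta> - n \<bullet> u) / \<tau>"
      by (simp add: diff_divide_distrib)
    have "(\<beta> - n \<bullet> u) / \<tau> \<le> r" if "h u < r" for r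
      using B[OF that] t by (simp add: field_simps)
    then show "((- 1 / \<tau>) *\<^sub>R n) \<bullet> u + \<beta> / \<tau> \<le> h u" unfolding * by (rule dense_ge)
    show "k u \<le> ((- 1 / \<tau>) *\<^sub>R n) \<bullet> u + \<beta> / \<tau>" if "u \<in> C"
      unfolding * using A[OF that order_refl] t by (simp add: field_simps)
  qed
qed

lemma is_norm_convex:
  assumes "is_norm nrm"
  shows "convex_on UNIV nrm"
proof (rule convex_onI)
  fix t :: real and x y assume "0 < t" "t < 1"
  moreover have "nrm ((1 - t) *\<^sub>R x + t *\<^sub>R y) \<le> nrm ((1 - t) *\<^sub>R x) + nrm (t *\<^sub>R y)"
    and "nrm ((1 - t) *\<^sub>R x) = \<bar>1 - t\<bar> * nrm x" "nrm (t *\<^sub>R y) = \<bar>t\<bar> * nrm y"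
    using assms unfolding is_norm_def by blast+
  ultimately show "nrm ((1 - t) *\<^sub>R x + t *\<^sub>R y) \<le> (1 - t) * nrm x + t * nrm y" by simp
qed simp

lemma is_norm_minus_commute:
  assumes "is_norm nrm"
  shows "nrm (x - y) = nrm (y - x)"
proof -
  have "nrm (- 1 *\<^sub>R (x - y)) = \<bar>- 1\<bar> * nrm (x - y)" using assms unfolding is_norm_def by blast
  then show ?thesis by simp
qed

lemma inner_le_dual_norm:
  assumes nrm: "is_norm nrm" and z: "dual_norm nrm z \<le> lam"
  shows "z \<bullet> u \<le> lam * nrm u"
proof (cases "u = 0")
  case False
  have pos: "0 < nrm u" and "nrm ((1 / nrm u) *\<^sub>R u) = \<bar>1 / nrm u\<bar> * nrm u"
    using nrm False unfolding is_norm_def by (metis order_le_less, blast)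
  then have "nrm ((1 / nrm u) *\<^sub>R u) \<le> 1" by simp
  then have "z \<bullet> ((1 / nrm u) *\<^sub>R u) \<le> lam" using z dual_norm_le_iff[OF nrm] by blast
  then show ?thesis using pos by (simp add: field_simps)
next
  case True
  then have "nrm u = 0" using nrm unfolding is_norm_def by blast
  then show ?thesis using True by simp
qed

text \<open>A supergradient at \<open>p\<close> bounds \<open>g\<close> by an affine function, whose slope is measured in the
given norm. This is what makes duality exact at radius 0, where no Slater point exists.\<close>

lemma concave_Lipschitz_above:
  fixes g :: "'a::euclidean_space \<Rightarrow> real"
  assumes nrm: "is_norm nrm" and g: "convex_on UNIV (\<lambda>u. - g u)"
  obtains L where "0 \<le> L" "\<And>u. g u \<le> g p + L * nrm (u - p)"
proof -
  obtain a b where ab: "\<And>u. a \<bullet> u + b \<le> - g u" "\<And>u. u \<in> {p} \<Longrightarrow> - g p \<le> a \<bullet> u + b"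
    using affine_sandwich[OF g, of "{p}" "\<lambda>_. - g p"] by (auto simp: concave_on_const)
  obtain c where c: "0 < c" "\<And>u. c * norm u \<le> nrm u" using is_norm_dominates[OF nrm] by blast
  show thesis
  proof
    show "0 \<le> norm a / c" using c by simp
    fix u
    have "g u \<le> g p - a \<bullet> (u - p)" using ab(1)[of u] ab(2)[of p] by (simp add: inner_diff_right)
    also have "- (a \<bullet> (u - p)) \<le> norm a * norm (u - p)"
      using norm_cauchy_schwarz[of "- a" "u - p"] by simp
    then have "g p - a \<bullet> (u - p) \<le> g p + norm a * norm (u - p)" by simp
    also have "norm (u - p) \<le> nrm (u - p) / c" using c(2)[of "u - p"] c(1) by (simp add: field_simps)
    then have "g p + norm a * norm (u - p) \<le> g p + norm a * (nrm (u - p) / c)"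
      by (intro add_left_mono mult_left_mono) auto
    finally show "g u \<le> g p + norm a / c * nrm (u - p)" by simp
  qed
qed

text \<open>Fenchel duality with attainment for the three convex functions \<open>-g\<close>,
\<open>lam * nrm (\<cdot> - p)\<close> and the indicator of \<open>\<Xi>\<close>, in two sandwich steps. The first
produces an affine function that is nonnegative on \<open>\<Xi>\<close> and whose slope is \<open>-\<nu>\<close>;
the second separates the norm term from the rest, and an affine minorant of
\<open>lam * nrm (\<cdot> - p)\<close> has a slope of dual norm at most \<open>lam\<close>; that slope is
\<open>-z\<close>.\<close>

lemma dual_certificate:
  fixes g :: "'a::euclidean_space \<Rightarrow> real"
  assumes nrm: "is_norm nrm" and g: "convex_on UNIV (\<lambda>u. - g u)"
    and \<Xi>: "convex \<Xi>" "\<Xi> \<noteq> {}" and lam: "0 \<le> lam"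
    and le: "\<And>\<xi>. \<xi> \<in> \<Xi> \<Longrightarrow> g \<xi> \<le> s + lam * nrm (\<xi> - p)"
  obtains z \<nu> where "dual_norm nrm z \<le> lam"
    "\<And>u \<xi>. \<xi> \<in> \<Xi> \<Longrightarrow> (z - \<nu>) \<bullet> u - (- g u) + \<nu> \<bullet> \<xi> - z \<bullet> p \<le> s"
proof -
  have zero: "nrm 0 = 0" and sc: "\<And>c v. nrm (c *\<^sub>R v) = \<bar>c\<bar> * nrm v"
    using nrm by (auto simp: is_norm_def)
  have "convex_on UNIV (\<lambda>u. nrm (u - p))"
  proof (rule convex_onI)
    fix t :: real and x y
    assume "0 < t" "t < 1"
    moreover have "(1 - t) *\<^sub>R x + t *\<^sub>R y - p = (1 - t) *\<^sub>R (x - p) + t *\<^sub>R (y - p)"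
      by (simp add: algebra_simps)
    ultimately show "nrm ((1 - t) *\<^sub>R x + t *\<^sub>R y - p) \<le> (1 - t) * nrm (x - p) + t * nrm (y - p)"
      using convex_onD[OF is_norm_convex[OF nrm], of t "x - p" "y - p"] by simp
  qed simp
  then have cn: "convex_on UNIV (\<lambda>u. lam * nrm (u - p))"
    by (rule convex_on_cmul[OF lam])
  have c1: "convex_on UNIV (\<lambda>u. (- g u + lam * nrm (u - p)) + s)"
    by (intro convex_on_add g cn) (simp add: convex_on_const)
  have c2: "concave_on \<Xi> (\<lambda>_. 0)" using \<Xi>(1) by (simp add: concave_on_const)
  have c3: "0 \<le> (- g u + lam * nrm (u - p)) + s" if "u \<in> \<Xi>" for u using le[OF that] by simp
  obtain a b where ab: "\<And>u. a \<bullet> u + b \<le> (- g u + lam * nrm (u - p)) + s"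
      "\<And>u. u \<in> \<Xi> \<Longrightarrow> 0 \<le> a \<bullet> u + b"
    using affine_sandwich[OF c1 c2 \<Xi>(2) c3] by blast
  have c4: "concave_on UNIV (\<lambda>u. (a \<bullet> u + b - s) + g u)"
  proof -
    have "convex_on UNIV (\<lambda>u. - g u + - (a \<bullet> u + b - s))"
    proof (rule convex_on_add[OF g], rule convex_onI)
      fix q :: real and x y
      show "- (a \<bullet> ((1 - q) *\<^sub>R x + q *\<^sub>R y) + b - s)
          \<le> (1 - q) * - (a \<bullet> x + b - s) + q * - (a \<bullet> y + b - s)"
        by (simp add: inner_add_right algebra_simps)
    qed simp
    then show ?thesis by (simp add: concave_on_def add.commute)
  qed
  obtain c d where cd: "\<And>u. c \<bullet> u + d \<le> lam * nrm (u - p)"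
      "\<And>u. (a \<bullet> u + b - s) + g u \<le> c \<bullet> u + d"
  proof (rule affine_sandwich[OF cn c4])
    show "(a \<bullet> u + b - s) + g u \<le> lam * nrm (u - p)" for u using ab(1)[of u] by simp
  qed auto
  have d: "c \<bullet> p + d \<le> 0" using cd(1)[of p] zero by simp
  have slope: "c \<bullet> v \<le> lam * nrm v" for v
  proof (rule ccontr)
    assume "\<not> c \<bullet> v \<le> lam * nrm v"
    then have pos: "0 < c \<bullet> v - lam * nrm v" by simp
    \<comment> \<open>Along the ray from \<open>p\<close> in direction \<open>v\<close> the affine minorant would overtake the norm term;
      \<open>q\<close> is a length at which it does.\<close>
    define q where "q = (1 - (c \<bullet> p + d)) / (c \<bullet> v - lam * nrm v)"
    have q: "0 < q" using pos d by (simp add: q_def)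
    have "c \<bullet> (p + q *\<^sub>R v) + d \<le> lam * nrm (q *\<^sub>R v)" using cd(1)[of "p + q *\<^sub>R v"] by simp
    then have "q * (c \<bullet> v - lam * nrm v) \<le> - (c \<bullet> p + d)"
      using q by (simp add: sc algebra_simps)
    then show False using pos by (simp add: q_def)
  qed
  show thesis
  proof (rule that[of "- c" "- a"])
    have "- c \<bullet> u \<le> lam" if "nrm u \<le> 1" for u
      using slope[of "- u"] sc[of "-1" u] that lam mult_left_le[of "nrm u" lam] by simp
    then show "dual_norm nrm (- c) \<le> lam" by (simp add: dual_norm_le_iff[OF nrm])
    fix u \<xi> assume "\<xi> \<in> \<Xi>"
    then show "(- c - - a) \<bullet> u - (- g u) + - a \<bullet> \<xi> - (- c) \<bullet> p \<le> s"
      using ab(2)[of \<xi>] cd(2)[of u] d by (simp add: inner_diff_left inner_add_left)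
  qed
qed

section \<open>Finitely supported laws as measures on a subspace\<close>

text \<open>A law on the whole type is carried to \<open>M\<close> by a retraction onto \<open>space M\<close>. The points
outside \<open>space M\<close> go to an arbitrary one inside; this is invisible as soon as the support of
\<open>\<pi>\<close> lies in \<open>space M\<close>. The discrete \<open>\<sigma>\<close>-algebra on the source makes every map
measurable, so that couplings can be built and integrated as finite sums.\<close>

definition pmf_on :: "'a measure \<Rightarrow> 'a pmf \<Rightarrow> 'a measure" where
  "pmf_on M \<pi> = distr (measure_pmf \<pi>) M (\<lambda>x. if x \<in> space M then x else SOME y. y \<in> space M)"

lemma sets_pmf_on [simp, measurable_cong]: "sets (pmf_on M \<pi>) = sets M"
  and space_pmf_on [simp]: "space (pmf_on M \<pi>) = space M"
  by (simp_all add: pmf_on_def)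

lemma retraction_measurable:
  assumes "set_pmf \<pi> \<subseteq> space M"
  shows "(\<lambda>x. if x \<in> space M then x else SOME y. y \<in> space M) \<in> measure_pmf \<pi> \<rightarrow>\<^sub>M M"
proof -
  have "space M \<noteq> {}" using assms set_pmf_not_empty[of \<pi>] by blast
  then show ?thesis by (auto simp: some_in_eq)
qed

lemma pmf_on_prob_algebra:
  assumes "set_pmf \<pi> \<subseteq> space M"
  shows "pmf_on M \<pi> \<in> space (prob_algebra M)"
  unfolding space_prob_algebra pmf_on_def
  using measure_pmf.prob_space_distr[OF retraction_measurable[OF assms]] by simp

lemma nn_integral_pmf_on:
  assumes "set_pmf \<pi> \<subseteq> space M" "g \<in> borel_measurable M"
  shows "(\<integral>\<^sup>+x. g x \<partial>pmf_on M \<pi>) = (\<integral>\<^sup>+x. g x \<partial>measure_pmf \<pi>)"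
  unfolding pmf_on_def using assms(1)
  by (subst nn_integral_distr[OF retraction_measurable[OF assms(1)]])
     (auto intro!: nn_integral_cong_AE simp: AE_measure_pmf_iff assms(2))

lemma integral_pmf_on:
  fixes g :: "_ \<Rightarrow> real"
  assumes "set_pmf \<pi> \<subseteq> space M" "g \<in> borel_measurable M"
  shows "(\<integral>x. g x \<partial>pmf_on M \<pi>) = measure_pmf.expectation \<pi> g"
  unfolding pmf_on_def using assms(1)
  by (subst integral_distr[OF retraction_measurable[OF assms(1)] assms(2)])
     (auto intro!: integral_cong_AE simp: AE_measure_pmf_iff)

lemma integrable_pmf_on:
  fixes g :: "_ \<Rightarrow> real"
  assumes "set_pmf \<pi> \<subseteq> space M" "finite (set_pmf \<pi>)" "g \<in> borel_measurable M"
  shows "integrable (pmf_on M \<pi>) g"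
  unfolding pmf_on_def
  by (subst integrable_distr_eq[OF retraction_measurable[OF assms(1)] assms(3)])
     (rule integrable_measure_pmf_finite[OF assms(2)])

lemma emeasure_pmf_on:
  assumes "set_pmf \<pi> \<subseteq> space M" "A \<in> sets M"
  shows "emeasure (pmf_on M \<pi>) A = emeasure (measure_pmf \<pi>) A"
  using nn_integral_pmf_on[OF assms(1), of "indicator A"] assms(2) by simp

lemma AE_pmf_on:
  assumes "set_pmf \<pi> \<subseteq> space M" "{x \<in> space M. P x} \<in> sets M" "\<And>x. x \<in> set_pmf \<pi> \<Longrightarrow> P x"
  shows "AE x in pmf_on M \<pi>. P x"
  unfolding pmf_on_def using assms(1,3)
  by (subst AE_distr_iff[OF retraction_measurable[OF assms(1)] assms(2)]) (auto simp: AE_measure_pmf_iff)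

lemma distr_pmf_on:
  assumes \<pi>: "set_pmf \<pi> \<subseteq> space M" and T: "T \<in> M \<rightarrow>\<^sub>M N"
  shows "distr (pmf_on M \<pi>) N T = pmf_on N (map_pmf T \<pi>)"
proof (rule measure_eqI)
  have T\<pi>: "set_pmf (map_pmf T \<pi>) \<subseteq> space N"
    using \<pi> measurable_space[OF T] by auto
  fix A assume "A \<in> sets (distr (pmf_on M \<pi>) N T)"
  then have A: "A \<in> sets N" by simp
  have "emeasure (distr (pmf_on M \<pi>) N T) A = emeasure (measure_pmf \<pi>) (T -` A \<inter> space M)"
    using T A by (simp add: emeasure_distr emeasure_pmf_on[OF \<pi> measurable_sets[OF T A]])
  also have "\<dots> = emeasure (measure_pmf \<pi>) (T -` A)"
    using \<pi> by (intro emeasure_eq_AE) (auto simp: AE_measure_pmf_iff)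
  also have "\<dots> = emeasure (pmf_on N (map_pmf T \<pi>)) A"
    by (simp add: emeasure_pmf_on[OF T\<pi> A] emeasure_map_pmf)
  finally show "emeasure (distr (pmf_on M \<pi>) N T) A = emeasure (pmf_on N (map_pmf T \<pi>)) A" .
qed simp

lemma pmf_with_weights:
  assumes "finite A" "\<And>a. a \<in> A \<Longrightarrow> 0 \<le> w a" "sum w A = 1"
  obtains W where "set_pmf W \<subseteq> A" "\<And>a. a \<in> A \<Longrightarrow> pmf W a = w a"
proof -
  define w' where "w' a = (if a \<in> A then w a else 0)" for a
  have nn: "0 \<le> w' a" for a using assms(2) by (simp add: w'_def)
  have "(\<integral>\<^sup>+a. ennreal (w' a) \<partial>count_space UNIV) = (\<Sum>a\<in>A. ennreal (w' a))"
    using assms(1) by (intro nn_integral_count_space') (auto simp: w'_def)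
  also have "\<dots> = ennreal (sum w' A)" using nn by (simp add: sum_ennreal)
  also have "sum w' A = 1" using assms(3) by (simp add: w'_def)
  finally have one: "(\<integral>\<^sup>+a. ennreal (w' a) \<partial>count_space UNIV) = 1" by simp
  show thesis
  proof
    show "set_pmf (embed_pmf w') \<subseteq> A"
      using set_embed_pmf[of w', OF nn one] by (auto simp: w'_def)
    show "pmf (embed_pmf w') a = w a" if "a \<in> A" for a
      using pmf_embed_pmf[of w' a, OF nn one] that by (simp add: w'_def)
  qed
qed

section \<open>Extended expectations\<close>

lemma expect_eq_integral:
  assumes "integrable M f"
  shows "expect M f = ereal (integral\<^sup>L M f)"
proof -
  have "(\<integral>\<^sup>+x. ennreal (f x) \<partial>M) < \<infinity>" "(\<integral>\<^sup>+x. ennreal (- f x) \<partial>M) < \<infinity>"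
    using assms by (auto simp: real_integrable_def less_top)
  then obtain p q where "0 \<le> p" "(\<integral>\<^sup>+x. ennreal (f x) \<partial>M) = ennreal p"
      "0 \<le> q" "(\<integral>\<^sup>+x. ennreal (- f x) \<partial>M) = ennreal q"
    by (metis ennreal_cases less_irrefl infinity_ennreal_def)
  then show ?thesis
    by (simp add: expect_def real_lebesgue_integral_def[OF assms])
qed

text \<open>An integrable upper bound keeps the positive part finite, so the extended expectation is either
\<open>-\<infinity>\<close> or an ordinary integral.\<close>

lemma expect_le_integral:
  assumes f: "f \<in> borel_measurable M" and u: "integrable M u" and le: "AE x in M. f x \<le> u x"
  shows "expect M f \<le> ereal (integral\<^sup>L M u)"
proof -
  have "(\<integral>\<^sup>+x. ennreal (f x) \<partial>M) \<le> (\<integral>\<^sup>+x. ennreal (u x) \<partial>M)"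
    using le by (intro nn_integral_mono_AE) (auto elim!: eventually_mono intro!: ennreal_leI)
  also have "\<dots> < \<infinity>" using u by (auto simp: real_integrable_def less_top)
  finally have pos: "(\<integral>\<^sup>+x. ennreal (f x) \<partial>M) < \<infinity>" .
  show ?thesis
  proof (cases "(\<integral>\<^sup>+x. ennreal (- f x) \<partial>M) = \<infinity>")
    case True
    then show ?thesis using pos
      by (cases "\<integral>\<^sup>+x. ennreal (f x) \<partial>M") (auto simp: expect_def)
  next
    case False
    then have int: "integrable M f" using f pos by (auto simp: real_integrable_def)
    then show ?thesis using integral_mono_AE[OF int u le] by (simp add: expect_eq_integral)
  qed
qed

lemma expect_distr:
  assumes "T \<in> M \<rightarrow>\<^sub>M N" "f \<in> borel_measurable N"
  shows "expect (distr M N T) f = expect M (\<lambda>x. f (T x))"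
  using assms by (simp add: expect_def nn_integral_distr)

section \<open>Couplings bound worst-case expectations\<close>

lemma is_norm_borel:
  fixes nrm :: "'a::euclidean_space \<Rightarrow> real"
  assumes "is_norm nrm"
  shows "nrm \<in> borel_measurable borel"
  using convex_on_continuous[OF open_UNIV is_norm_convex[OF assms]]
  by (rule borel_measurable_continuous_onI)

lemma cost_measurable:
  fixes nrm :: "'a::euclidean_space \<Rightarrow> real"
  assumes "is_norm nrm"
  shows "(\<lambda>z. nrm (fst z - snd z)) \<in> borel_measurable (borel_on \<Xi> \<Otimes>\<^sub>M borel_on \<Xi>)"
proof -
  have id: "(\<lambda>x. x) \<in> borel_on \<Xi> \<rightarrow>\<^sub>M borel" by (rule measurable_restrict_space1) simp
  have "fst \<in> (borel_on \<Xi> \<Otimes>\<^sub>M borel_on \<Xi>) \<rightarrow>\<^sub>M borel" "snd \<in> (borel_on \<Xi> \<Otimes>\<^sub>M borel_on \<Xi>) \<rightarrow>\<^sub>M borel"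
    by (rule measurable_compose[OF measurable_fst id], rule measurable_compose[OF measurable_snd id])
  then show ?thesis
    by (intro measurable_compose[OF borel_measurable_diff is_norm_borel[OF assms]])
qed

text \<open>Integrate \<open>f \<xi> \<le> S y + lam * nrm (\<xi> - y)\<close> against a coupling of \<open>Q\<close> and
\<open>P\<close>. The infimum in the Wasserstein distance need not be attained for this: couplings whose
cost is within \<open>\<delta>\<close> of the radius suffice, and \<open>\<delta>\<close> tends to 0.\<close>

lemma weak_duality:
  fixes nrm :: "'a::euclidean_space \<Rightarrow> real"
  assumes nrm: "is_norm nrm" and f: "f \<in> borel_measurable borel"
    and P: "finite (set_pmf P)" "set_pmf P \<subseteq> \<Xi>" and lam: "0 \<le> lam" and eps: "0 \<le> \<epsilon>"
    and le: "\<And>y \<xi>. y \<in> set_pmf P \<Longrightarrow> \<xi> \<in> \<Xi> \<Longrightarrow> f \<xi> \<le> S y + lam * nrm (\<xi> - y)"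
    and Q: "Q \<in> wasserstein_ball nrm \<Xi> \<epsilon> (pmf_on (borel_on \<Xi>) P)"
  shows "expect Q f \<le> ereal (lam * \<epsilon> + measure_pmf.expectation P S)"
proof (rule ereal_le_epsilon2)
  fix e :: real assume e: "0 < e"
  define \<delta> where "\<delta> = e / (lam + 1)"
  have \<delta>: "0 < \<delta>" "lam * \<delta> \<le> e"
    using e lam by (auto simp: \<delta>_def field_simps)
  let ?M = "borel_on \<Xi>" and ?MM = "borel_on \<Xi> \<Otimes>\<^sub>M borel_on \<Xi>"
  have sp: "space ?M = \<Xi>" by (simp add: space_restrict_space)
  have PM: "set_pmf P \<subseteq> space ?M" using P by (simp add: sp)
  have "wasserstein nrm \<Xi> (pmf_on ?M P) Q \<le> ennreal \<epsilon>"
    using Q by (simp add: wasserstein_ball_def)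
  also have "\<dots> < ennreal (\<epsilon> + \<delta>)" using \<delta> eps by (simp add: ennreal_lessI)
  finally obtain \<gamma> where \<gamma>: "\<gamma> \<in> couplings \<Xi> Q (pmf_on ?M P)"
      and cost: "(\<integral>\<^sup>+z. ennreal (nrm (fst z - snd z)) \<partial>\<gamma>) < ennreal (\<epsilon> + \<delta>)"
    unfolding wasserstein_def INF_less_iff by (auto simp: case_prod_unfold)
  have sets: "sets \<gamma> = sets ?MM" and fst: "distr \<gamma> ?M fst = Q" and snd: "distr \<gamma> ?M snd = pmf_on ?M P"
    using \<gamma> by (auto simp: couplings_def space_prob_algebra)
  have [measurable]: "fst \<in> \<gamma> \<rightarrow>\<^sub>M ?M" "snd \<in> \<gamma> \<rightarrow>\<^sub>M ?M"
    by (simp_all add: measurable_cong_sets[OF sets refl])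
  have cm: "(\<lambda>z. nrm (fst z - snd z)) \<in> borel_measurable \<gamma>"
    using cost_measurable[OF nrm] by (simp add: measurable_cong_sets[OF sets refl])
  have nn: "0 \<le> nrm v" for v using nrm by (simp add: is_norm_def)
  have ci: "integrable \<gamma> (\<lambda>z. nrm (fst z - snd z))"
    using cost by (intro integrableI_nonneg cm) (auto simp: nn top_unique intro: order_less_trans)
  have "ennreal (\<integral>z. nrm (fst z - snd z) \<partial>\<gamma>) < ennreal (\<epsilon> + \<delta>)"
    using cost nn_integral_eq_integral[OF ci] by (simp add: nn)
  then have cb: "(\<integral>z. nrm (fst z - snd z) \<partial>\<gamma>) \<le> \<epsilon> + \<delta>"
    using \<delta> eps by (subst (asm) ennreal_less_iff) (auto simp: nn)
  \<comment> \<open>Off the finite support \<open>S\<close> is arbitrary, hence possibly not measurable.\<close>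
  define S' where "S' y = (\<Sum>q\<in>set_pmf P. S q * indicator {q} y)" for y
  have S'S: "S' y = S y" if "y \<in> set_pmf P" for y
    using that P(1) by (simp add: S'_def indicator_def sum.delta' if_distrib cong: if_cong)
  have S'b: "S' \<in> borel_measurable borel" unfolding S'_def by measurable
  have S'm: "S' \<in> borel_measurable ?M" by (rule measurable_restrict_space1[OF S'b])
  have fm: "f \<in> borel_measurable ?M" by (rule measurable_restrict_space1[OF f])
  have S'i: "integrable \<gamma> (\<lambda>z. S' (snd z))"
    using integrable_pmf_on[OF PM P(1) S'm] unfolding snd[symmetric]
    by (subst (asm) integrable_distr_eq) (use S'm in auto)
  have "(\<integral>z. S' (snd z) \<partial>\<gamma>) = (\<integral>y. S' y \<partial>pmf_on ?M P)"
    unfolding snd[symmetric] by (subst integral_distr) (use S'm in auto)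
  also have "\<dots> = measure_pmf.expectation P S"
    unfolding integral_pmf_on[OF PM S'm]
    by (intro integral_cong_AE) (auto simp: AE_measure_pmf_iff S'S)
  finally have S'e: "(\<integral>z. S' (snd z) \<partial>\<gamma>) = measure_pmf.expectation P S" .
  have fin: "{y \<in> space ?M. y \<in> set_pmf P} \<in> sets ?M"
    using P by (auto simp: sets_restrict_space sp intro!: image_eqI[of _ _ "set_pmf P"] finite_imp_closed borel_closed)
  have "AE y in distr \<gamma> ?M snd. y \<in> set_pmf P"
    unfolding snd by (rule AE_pmf_on[OF PM fin])
  then have "AE z in \<gamma>. snd z \<in> set_pmf P"
    by (subst (asm) AE_distr_iff) (use fin in auto)
  moreover have "AE z in \<gamma>. fst z \<in> \<Xi>"
  proof (rule AE_I2)
    fix z assume "z \<in> space \<gamma>"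
    also have "space \<gamma> = \<Xi> \<times> \<Xi>"
      unfolding sets_eq_imp_space_eq[OF sets] space_pair_measure sp ..
    finally show "fst z \<in> \<Xi>" by auto
  qed
  ultimately have ae: "AE z in \<gamma>. f (fst z) \<le> S' (snd z) + lam * nrm (fst z - snd z)"
    by eventually_elim (simp add: le S'S)
  have "expect Q f = expect \<gamma> (\<lambda>z. f (fst z))"
    unfolding fst[symmetric] by (rule expect_distr) (use fm in auto)
  also have "\<dots> \<le> ereal (\<integral>z. S' (snd z) + lam * nrm (fst z - snd z) \<partial>\<gamma>)"
    using S'i ci fm by (intro expect_le_integral ae) auto
  also have "(\<integral>z. S' (snd z) + lam * nrm (fst z - snd z) \<partial>\<gamma>)
      = measure_pmf.expectation P S + lam * (\<integral>z. nrm (fst z - snd z) \<partial>\<gamma>)"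
    using S'i ci by (simp add: S'e)
  also have "\<dots> \<le> measure_pmf.expectation P S + lam * (\<epsilon> + \<delta>)"
    using lam cb by (intro add_left_mono mult_left_mono)
  also have "\<dots> \<le> lam * \<epsilon> + measure_pmf.expectation P S + e"
    using \<delta> by (simp add: algebra_simps)
  finally show "expect Q f \<le> ereal (lam * \<epsilon> + measure_pmf.expectation P S) + ereal e" by simp
qed

text \<open>As in \<open>couplings\<close>, the second marginal is the reference law.\<close>

definition finite_plans :: "'a set \<Rightarrow> 'a pmf \<Rightarrow> ('a \<times> 'a) pmf set" where
  "finite_plans \<Xi> P = {\<pi>. finite (set_pmf \<pi>) \<and> set_pmf \<pi> \<subseteq> \<Xi> \<times> \<Xi> \<and> map_pmf snd \<pi> = P}"

lemma finite_plan_expect_le_SUP: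
  fixes nrm :: "'a::euclidean_space \<Rightarrow> real"
  assumes nrm: "is_norm nrm" and f: "f \<in> borel_measurable borel"
    and \<pi>: "\<pi> \<in> finite_plans \<Xi> P"
    and cost: "measure_pmf.expectation \<pi> (\<lambda>z. nrm (fst z - snd z)) \<le> \<epsilon>"
  shows "ereal (measure_pmf.expectation \<pi> (\<lambda>z. f (fst z)))
    \<le> (SUP Q\<in>wasserstein_ball nrm \<Xi> \<epsilon> (pmf_on (borel_on \<Xi>) P). expect Q f)"
proof -
  let ?M = "borel_on \<Xi>" and ?MM = "borel_on \<Xi> \<Otimes>\<^sub>M borel_on \<Xi>"
  have sp: "space ?M = \<Xi>" by (simp add: space_restrict_space)
  have fin: "finite (set_pmf \<pi>)" and sub: "set_pmf \<pi> \<subseteq> space ?MM" and P: "map_pmf snd \<pi> = P"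
    using \<pi> by (auto simp: finite_plans_def space_pair_measure sp)
  have nn: "0 \<le> nrm v" for v using nrm by (simp add: is_norm_def)
  define Q where "Q = pmf_on ?M (map_pmf fst \<pi>)"
  have finQ: "finite (set_pmf (map_pmf fst \<pi>))" and subQ: "set_pmf (map_pmf fst \<pi>) \<subseteq> space ?M"
    using fin sub by (auto simp: space_pair_measure)
  have "pmf_on ?MM \<pi> \<in> couplings \<Xi> Q (pmf_on ?M P)"
    unfolding couplings_def Q_def using pmf_on_prob_algebra[OF sub]
    by (simp add: distr_pmf_on[OF sub] P)
  moreover have "(\<integral>\<^sup>+z. ennreal (nrm (fst z - snd z)) \<partial>pmf_on ?MM \<pi>) \<le> ennreal \<epsilon>"
  proof -
    have "(\<integral>\<^sup>+z. ennreal (nrm (fst z - snd z)) \<partial>pmf_on ?MM \<pi>)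
        = (\<integral>\<^sup>+z. ennreal (nrm (fst z - snd z)) \<partial>measure_pmf \<pi>)"
      by (rule nn_integral_pmf_on[OF sub]) (use cost_measurable[OF nrm] in measurable)
    also have "\<dots> = ennreal (measure_pmf.expectation \<pi> (\<lambda>z. nrm (fst z - snd z)))"
      using fin by (intro nn_integral_eq_integral integrable_measure_pmf_finite) (auto simp: nn)
    finally show ?thesis using cost by (simp add: ennreal_leI)
  qed
  ultimately have "wasserstein nrm \<Xi> (pmf_on ?M P) Q \<le> ennreal \<epsilon>"
    unfolding wasserstein_def by (intro INF_lower2) (auto simp: case_prod_unfold)
  moreover have "Q \<in> prob_dists nrm \<Xi>"
  proof -
    have "(\<integral>\<^sup>+\<xi>. ennreal (nrm \<xi>) \<partial>Q) = (\<integral>\<^sup>+\<xi>. ennreal (nrm \<xi>) \<partial>measure_pmf (map_pmf fst \<pi>))"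
      unfolding Q_def
      using measurable_restrict_space1[OF is_norm_borel[OF nrm]] by (intro nn_integral_pmf_on[OF subQ]) auto
    also have "\<dots> < \<infinity>"
      unfolding nn_integral_measure_pmf_finite[OF finQ zero_le]
      using finQ by (auto simp: ennreal_mult_less_top simp del: set_map_pmf)
    finally show ?thesis using pmf_on_prob_algebra[OF subQ] by (simp add: prob_dists_def Q_def)
  qed
  ultimately have "Q \<in> wasserstein_ball nrm \<Xi> \<epsilon> (pmf_on ?M P)" by (simp add: wasserstein_ball_def)
  moreover have "expect Q f = ereal (measure_pmf.expectation \<pi> (\<lambda>z. f (fst z)))"
  proof -
    have fm: "f \<in> borel_measurable ?M" by (rule measurable_restrict_space1[OF f])
    have "expect Q f = ereal (\<integral>\<xi>. f \<xi> \<partial>Q)"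
      unfolding Q_def by (rule expect_eq_integral[OF integrable_pmf_on[OF subQ finQ fm]])
    also have "(\<integral>\<xi>. f \<xi> \<partial>Q) = measure_pmf.expectation \<pi> (\<lambda>z. f (fst z))"
      unfolding Q_def integral_pmf_on[OF subQ fm] by simp
    finally show ?thesis .
  qed
  ultimately show ?thesis by (intro SUP_upper2) auto
qed

section \<open>Existence of a Lagrange multiplier\<close>

text \<open>The mixing coin is independent of the second marginal, which is \<open>P\<close> on either side. This is
the convexity behind the multiplier.\<close>

lemma finite_plans_mixture:
  assumes \<pi>1: "\<pi>1 \<in> finite_plans \<Xi> P" and \<pi>2: "\<pi>2 \<in> finite_plans \<Xi> P" and q: "0 \<le> q" "q \<le> 1"
  obtains \<pi> where "\<pi> \<in> finite_plans \<Xi> P"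
    "\<And>h :: _ \<Rightarrow> real. measure_pmf.expectation \<pi> h
       = q * measure_pmf.expectation \<pi>1 h + (1 - q) * measure_pmf.expectation \<pi>2 h"
proof
  define \<pi> where "\<pi> = bind_pmf (bernoulli_pmf q) (\<lambda>b. if b then \<pi>1 else \<pi>2)"
  have fin: "finite (set_pmf \<pi>1)" "finite (set_pmf \<pi>2)"
    using \<pi>1 \<pi>2 by (auto simp: finite_plans_def)
  have "set_pmf \<pi> \<subseteq> set_pmf \<pi>1 \<union> set_pmf \<pi>2" by (auto simp: \<pi>_def split: if_splits)
  moreover have "map_pmf snd \<pi> = bind_pmf (bernoulli_pmf q) (\<lambda>_. P)"
    unfolding \<pi>_def map_bind_pmf using \<pi>1 \<pi>2
    by (intro bind_pmf_cong) (auto simp: finite_plans_def)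
  ultimately show "\<pi> \<in> finite_plans \<Xi> P"
    using \<pi>1 \<pi>2 finite_subset[of "set_pmf \<pi>" "set_pmf \<pi>1 \<union> set_pmf \<pi>2"]
    by (auto simp: finite_plans_def)
  fix h :: "_ \<Rightarrow> real"
  show "measure_pmf.expectation \<pi> h
       = q * measure_pmf.expectation \<pi>1 h + (1 - q) * measure_pmf.expectation \<pi>2 h"
    unfolding \<pi>_def using fin q
    by (subst pmf_expectation_bind[of UNIV]) (auto simp: UNIV_bool)
qed

lemma transport_map_plan:
  assumes "finite (set_pmf P)" "set_pmf P \<subseteq> \<Xi>" "\<And>y. y \<in> set_pmf P \<Longrightarrow> T y \<in> \<Xi>"
  shows "map_pmf (\<lambda>y. (T y, y)) P \<in> finite_plans \<Xi> P"
  using assms by (auto simp: finite_plans_def map_pmf_comp)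

text \<open>The pairs (transport budget, attainable value) form a convex set in the plane. The ray above
\<open>(\<epsilon>, v)\<close> misses it, and \<open>lam\<close> is the slope of a separating line. This line is
not vertical because the identity plan has cost 0, strictly below \<open>\<epsilon>\<close>: that is Slater's
condition.\<close>

lemma multiplier_exists:
  fixes c f :: "'a \<times> 'a \<Rightarrow> real"
  assumes P: "finite (set_pmf P)" "set_pmf P \<subseteq> \<Xi>" and c0: "\<And>y. c (y, y) = 0" and eps: "0 < \<epsilon>"
    and le: "\<And>\<pi>. \<pi> \<in> finite_plans \<Xi> P \<Longrightarrow> measure_pmf.expectation \<pi> c \<le> \<epsilon> \<Longrightarrow>
      measure_pmf.expectation \<pi> f \<le> v"
  obtains lam where "0 \<le> lam"
    "\<And>\<pi>. \<pi> \<in> finite_plans \<Xi> P \<Longrightarrow>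
      lam * \<epsilon> + (measure_pmf.expectation \<pi> f - lam * measure_pmf.expectation \<pi> c) \<le> v"
proof -
  let ?E = measure_pmf.expectation
  let ?A = "{(r, u). \<exists>\<pi>\<in>finite_plans \<Xi> P. ?E \<pi> c \<le> r \<and> u \<le> ?E \<pi> f}" and ?B = "{\<epsilon>} \<times> {v<..}"
  define \<pi>0 where "\<pi>0 = map_pmf (\<lambda>y. (y, y)) P"
  have \<pi>0: "\<pi>0 \<in> finite_plans \<Xi> P" "?E \<pi>0 c = 0"
    using transport_map_plan[OF P, of "\<lambda>y. y"] P by (auto simp: \<pi>0_def c0)
  have "convex ?A"
  proof (rule convexI, clarsimp)
    fix r1 u1 r2 u2 p q :: real and \<pi>1 \<pi>2
    assume *: "0 \<le> p" "0 \<le> q" "p + q = 1" "\<pi>1 \<in> finite_plans \<Xi> P" "\<pi>2 \<in> finite_plans \<Xi> P"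
      "?E \<pi>1 c \<le> r1" "u1 \<le> ?E \<pi>1 f" "?E \<pi>2 c \<le> r2" "u2 \<le> ?E \<pi>2 f"
    then have q: "q = 1 - p" "p \<le> 1" by auto
    obtain \<pi> where \<pi>: "\<pi> \<in> finite_plans \<Xi> P"
        "\<And>h :: _ \<Rightarrow> real. ?E \<pi> h = p * ?E \<pi>1 h + (1 - p) * ?E \<pi>2 h"
      using finite_plans_mixture[OF *(4,5,1) q(2)] by blast
    have "?E \<pi> c \<le> p * r1 + q * r2" "p * u1 + q * u2 \<le> ?E \<pi> f"
      unfolding \<pi>(2) q(1)[symmetric] using * by (auto intro!: add_mono mult_left_mono)
    then show "\<exists>\<pi>\<in>finite_plans \<Xi> P. ?E \<pi> c \<le> p * r1 + q * r2 \<and> p * u1 + q * u2 \<le> ?E \<pi> f"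
      using \<pi>(1) by blast
  qed
  moreover have "convex ?B" by (intro convex_Times) auto
  moreover have "?A \<noteq> {}" using \<pi>0(1) by auto
  moreover have "?B \<noteq> {}" by (auto intro: gt_ex)
  moreover have "?A \<inter> ?B = {}" using le by force
  ultimately obtain ab \<beta> where ab: "ab \<noteq> 0" "\<forall>x\<in>?A. ab \<bullet> x \<le> \<beta>" "\<forall>x\<in>?B. ab \<bullet> x \<ge> \<beta>"
    using separating_hyperplane_sets by meson
  obtain a b where [simp]: "ab = (a, b)" by (cases ab)
  have A: "a * r + b * u \<le> \<beta>" if "\<pi> \<in> finite_plans \<Xi> P" "?E \<pi> c \<le> r" "u \<le> ?E \<pi> f" for \<pi> r u
    using ab(2) that by auto
  have B: "\<beta> \<le> a * \<epsilon> + b * u" if "v < u" for u using ab(3) that by auto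
  have b0: "0 \<le> b"
  proof (rule ccontr)
    assume neg: "\<not> 0 \<le> b"
    define u where "u = min (?E \<pi>0 f) ((\<beta> + 1) / b)"
    have "b * ((\<beta> + 1) / b) \<le> b * u" using neg by (intro mult_left_mono_neg) (auto simp: u_def)
    then show False using A[OF \<pi>0(1), of 0 u] \<pi>0(2) neg by (simp add: u_def)
  qed
  have a0: "a \<le> 0"
  proof (rule ccontr)
    assume pos: "\<not> a \<le> 0"
    define r where "r = max 0 ((\<beta> + 1 - b * ?E \<pi>0 f) / a)"
    have "a * ((\<beta> + 1 - b * ?E \<pi>0 f) / a) \<le> a * r" using pos by (intro mult_left_mono) (auto simp: r_def)
    then show False using A[OF \<pi>0(1), of r "?E \<pi>0 f"] \<pi>0(2) pos by (simp add: r_def)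
  qed
  have "b \<noteq> 0"
  proof
    assume 0: "b = 0"
    then have "a < 0" using ab(1) a0 by (auto simp: zero_prod_def)
    then have "a * \<epsilon> < 0" using eps by (simp add: mult_neg_pos)
    moreover have "0 \<le> \<beta>" using A[OF \<pi>0(1), of 0 "?E \<pi>0 f"] \<pi>0(2) 0 by simp
    ultimately show False using B[of "v + 1"] 0 by simp
  qed
  then have b: "0 < b" using b0 by simp
  show thesis
  proof
    show "0 \<le> - a / b" using a0 b by (simp add: divide_nonpos_pos)
    fix \<pi> assume \<pi>: "\<pi> \<in> finite_plans \<Xi> P"
    have "- a / b * \<epsilon> + (?E \<pi> f - - a / b * ?E \<pi> c) \<le> u" if "v < u" for u
    proof -
      have "a * ?E \<pi> c + b * ?E \<pi> f \<le> a * \<epsilon> + b * u"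
        using A[OF \<pi> order_refl order_refl] B[OF that] by linarith
      then have "(a * ?E \<pi> c + b * ?E \<pi> f) / b \<le> (a * \<epsilon> + b * u) / b"
        using b by (simp add: divide_right_mono)
      then show ?thesis using b by (simp add: add_divide_distrib)
    qed
    then show "- a / b * \<epsilon> + (?E \<pi> f - - a / b * ?E \<pi> c) \<le> v" by (rule dense_ge)
  qed
qed

text \<open>A bound on a weighted sum that holds for every choice of one point per summand also holds for the
sum of the separate suprema. Moving a single coordinate of the choice shows that each of these
suprema is finite, as all weights are positive.\<close>

lemma sum_SUP_le_by_selection:
  fixes \<phi> :: "'a \<Rightarrow> 'b \<Rightarrow> real"
  assumes F: "finite F" "\<And>y. y \<in> F \<Longrightarrow> 0 < w y" "sum w F = 1" and ne: "C \<noteq> {}"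
    and le: "\<And>T. (\<And>y. y \<in> F \<Longrightarrow> T y \<in> C) \<Longrightarrow> (\<Sum>y\<in>F. w y * \<phi> y (T y)) \<le> B"
  shows "\<And>y. y \<in> F \<Longrightarrow> bdd_above (\<phi> y ` C)"
    and "(\<Sum>y\<in>F. w y * (SUP \<xi>\<in>C. \<phi> y \<xi>)) \<le> B"
proof -
  obtain c where c: "c \<in> C" using ne by blast
  show bdd: "bdd_above (\<phi> y ` C)" if y: "y \<in> F" for y
  proof (rule bdd_aboveI2)
    fix \<xi> assume \<xi>: "\<xi> \<in> C"
    have "(\<Sum>z\<in>F. w z * \<phi> z (((\<lambda>_. c)(y := \<xi>)) z)) \<le> B" using c \<xi> by (intro le) auto
    also have "(\<Sum>z\<in>F. w z * \<phi> z (((\<lambda>_. c)(y := \<xi>)) z)) = w y * \<phi> y \<xi> + (\<Sum>z\<in>F - {y}. w z * \<phi> z c)"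
      by (subst sum.remove[OF F(1) y]) (auto intro: sum.cong)
    finally show "\<phi> y \<xi> \<le> (B - (\<Sum>z\<in>F - {y}. w z * \<phi> z c)) / w y"
      using F(2)[OF y] by (simp add: field_simps)
  qed
  show "(\<Sum>y\<in>F. w y * (SUP \<xi>\<in>C. \<phi> y \<xi>)) \<le> B"
  proof (rule field_le_epsilon)
    fix e :: real assume "0 < e"
    have "\<exists>\<xi>\<in>C. (SUP \<xi>\<in>C. \<phi> y \<xi>) - e < \<phi> y \<xi>" if "y \<in> F" for y
      using \<open>0 < e\<close> by (subst less_cSUP_iff[symmetric, OF ne bdd[OF that]]) simp
    then obtain T where T: "\<And>y. y \<in> F \<Longrightarrow> T y \<in> C \<and> (SUP \<xi>\<in>C. \<phi> y \<xi>) - e < \<phi> y (T y)"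
      by metis
    have "(\<Sum>y\<in>F. w y * (SUP \<xi>\<in>C. \<phi> y \<xi>)) - e = (\<Sum>y\<in>F. w y * ((SUP \<xi>\<in>C. \<phi> y \<xi>) - e))"
      using F(3) by (simp add: right_diff_distrib sum_subtractf flip: sum_distrib_right)
    also have "\<dots> \<le> (\<Sum>y\<in>F. w y * \<phi> y (T y))"
      using T F(2) by (intro sum_mono mult_left_mono) (auto intro: less_imp_le)
    also have "\<dots> \<le> B" using T by (intro le) auto
    finally show "(\<Sum>y\<in>F. w y * (SUP \<xi>\<in>C. \<phi> y \<xi>)) \<le> B + e" by simp
  qed
qed

text \<open>A multiplier turns the budget constraint into a penalty, after which mass at different atoms of
\<open>P\<close> is moved independently; the best penalised value from \<open>y\<close> is \<open>S y\<close>. At radius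
0 there is no multiplier from separation, but by \<open>lip\<close> a large penalty makes staying put
optimal at every point of \<open>D\<close>, with \<open>S = f\<close>. The set \<open>D\<close> may contain points that
carry no mass: sample points of weight zero still impose constraints.\<close>

lemma dual_potential_exists:
  fixes nrm :: "'a::euclidean_space \<Rightarrow> real"
  assumes nrm: "is_norm nrm" and P: "finite (set_pmf P)" "set_pmf P \<subseteq> \<Xi>" and eps: "0 \<le> \<epsilon>"
    and D: "finite D" "D \<subseteq> \<Xi>" "set_pmf P \<subseteq> D"
    and lip: "\<And>y. y \<in> D \<Longrightarrow> \<exists>L\<ge>0. \<forall>\<xi>\<in>\<Xi>. f \<xi> \<le> f y + L * nrm (\<xi> - y)"
    and le: "\<And>\<pi>. \<pi> \<in> finite_plans \<Xi> P \<Longrightarrow>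
      measure_pmf.expectation \<pi> (\<lambda>z. nrm (fst z - snd z)) \<le> \<epsilon> \<Longrightarrow>
      measure_pmf.expectation \<pi> (\<lambda>z. f (fst z)) \<le> v"
  obtains lam S where "0 \<le> lam" "\<And>y \<xi>. y \<in> D \<Longrightarrow> \<xi> \<in> \<Xi> \<Longrightarrow> f \<xi> \<le> S y + lam * nrm (\<xi> - y)"
    "lam * \<epsilon> + measure_pmf.expectation P S \<le> v"
proof -
  have zero: "nrm 0 = 0" and nn: "\<And>x. 0 \<le> nrm x" and tri: "\<And>x y. nrm (x + y) \<le> nrm x + nrm y"
    using nrm by (auto simp: is_norm_def)
  show thesis
  proof (cases "\<epsilon> = 0")
    case True
    obtain L where L: "\<And>y. y \<in> D \<Longrightarrow> 0 \<le> L y"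
        "\<And>y \<xi>. y \<in> D \<Longrightarrow> \<xi> \<in> \<Xi> \<Longrightarrow> f \<xi> \<le> f y + L y * nrm (\<xi> - y)"
      using lip by metis
    have "f \<xi> \<le> f y + sum L D * nrm (\<xi> - y)" if "y \<in> D" "\<xi> \<in> \<Xi>" for y \<xi>
      using L(2)[OF that] mult_right_mono[OF member_le_sum[OF that(1) _ D(1), of L] nn] L(1)
      by (meson Diff_iff add_left_mono order_trans)
    moreover have "0 \<le> sum L D" using L(1) by (intro sum_nonneg)
    moreover have "measure_pmf.expectation P f \<le> v"
      using le[OF transport_map_plan[OF P, of "\<lambda>y. y"]] P eps by (auto simp: zero)
    ultimately show thesis using True by (intro that[of "sum L D" f]) auto
  next
    case False
    then have eps: "0 < \<epsilon>" using eps by simp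
    obtain lam where lam: "0 \<le> lam"
        "\<And>\<pi>. \<pi> \<in> finite_plans \<Xi> P \<Longrightarrow> lam * \<epsilon> + (measure_pmf.expectation \<pi> (\<lambda>z. f (fst z))
           - lam * measure_pmf.expectation \<pi> (\<lambda>z. nrm (fst z - snd z))) \<le> v"
      using multiplier_exists[OF P _ eps, of "\<lambda>z. nrm (fst z - snd z)" "\<lambda>z. f (fst z)" v] le zero
      by auto
    define \<phi> where "\<phi> y \<xi> = f \<xi> - lam * nrm (\<xi> - y)" for y \<xi>
    define S where "S y = (SUP \<xi>\<in>\<Xi>. \<phi> y \<xi>)" for y
    have sel: "(\<Sum>y\<in>set_pmf P. pmf P y * \<phi> y (T y)) \<le> v - lam * \<epsilon>"
      if T: "\<And>y. y \<in> set_pmf P \<Longrightarrow> T y \<in> \<Xi>" for T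
    proof -
      have "lam * \<epsilon> + (measure_pmf.expectation P (\<lambda>y. f (T y))
          - lam * measure_pmf.expectation P (\<lambda>y. nrm (T y - y))) \<le> v"
        using lam(2)[OF transport_map_plan[OF P T]] by simp
      also have "measure_pmf.expectation P (\<lambda>y. f (T y)) - lam * measure_pmf.expectation P (\<lambda>y. nrm (T y - y))
          = measure_pmf.expectation P (\<lambda>y. \<phi> y (T y))"
        unfolding \<phi>_def using P(1) by (simp add: integrable_measure_pmf_finite)
      also have "\<dots> = (\<Sum>y\<in>set_pmf P. pmf P y * \<phi> y (T y))"
        using P(1) by (subst integral_measure_pmf[of "set_pmf P"]) auto
      finally show ?thesis by simp
    qed
    have ne: "\<Xi> \<noteq> {}" using P(2) set_pmf_not_empty[of P] by blast
    have sum1: "sum (pmf P) (set_pmf P) = 1" using P(1) by (intro sum_pmf_eq_1) auto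
    have sup: "bdd_above (\<phi> y ` \<Xi>)" if "y \<in> set_pmf P" for y
      by (rule sum_SUP_le_by_selection(1)[OF P(1) _ sum1 ne _ that])
         (auto simp: pmf_positive intro: sel)
    have "(\<Sum>y\<in>set_pmf P. pmf P y * S y) \<le> v - lam * \<epsilon>"
      unfolding S_def
      by (rule sum_SUP_le_by_selection(2)[OF P(1) _ sum1 ne]) (auto simp: pmf_positive intro: sel)
    then have val: "lam * \<epsilon> + measure_pmf.expectation P S \<le> v"
      using P(1) by (subst integral_measure_pmf[of "set_pmf P"]) auto
    \<comment> \<open>Finiteness of the supremum at one atom spreads to all \<open>y\<close> by the triangle inequality.\<close>
    obtain y0 where y0: "y0 \<in> set_pmf P" using set_pmf_not_empty[of P] by blast
    then obtain M where M: "\<And>\<xi>. \<xi> \<in> \<Xi> \<Longrightarrow> \<phi> y0 \<xi> \<le> M"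
      using sup[OF y0] by (auto simp: bdd_above_def)
    have "f \<xi> \<le> S y + lam * nrm (\<xi> - y)" if "\<xi> \<in> \<Xi>" for y \<xi>
    proof -
      have "\<phi> y \<zeta> \<le> M + lam * nrm (y - y0)" if "\<zeta> \<in> \<Xi>" for \<zeta>
      proof -
        have "lam * nrm (\<zeta> - y0) \<le> lam * (nrm (\<zeta> - y) + nrm (y - y0))"
          using tri[of "\<zeta> - y" "y - y0"] lam(1) by (intro mult_left_mono) simp_all
        then show ?thesis using M[OF that] by (simp add: \<phi>_def algebra_simps)
      qed
      then have "bdd_above (\<phi> y ` \<Xi>)" by (rule bdd_aboveI2)
      then have "\<phi> y \<xi> \<le> S y" unfolding S_def by (rule cSUP_upper[OF that])
      then show ?thesis by (simp add: \<phi>_def)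
    qed
    then show thesis using lam(1) val by (intro that) auto
  qed
qed

section \<open>Strong duality\<close>

text \<open>Sample points may coincide, so the weights live on the index pairs and are pushed forward.\<close>

lemma weighted_empirical_eq_pmf_on:
  assumes p: "\<And>h i. h \<in> {1..H} \<Longrightarrow> i \<in> {1..I} \<Longrightarrow> p h i \<in> \<Xi>"
    and I: "0 < I" and t: "\<And>h. h \<in> {1..H} \<Longrightarrow> 0 \<le> t h" "(\<Sum>h=1..H. t h) = 1"
  obtains P where "set_pmf P \<subseteq> (\<lambda>(h, i). p h i) ` ({1..H} \<times> {1..I})"
    "weighted_empirical \<Xi> H I t p = pmf_on (borel_on \<Xi>) P"
    "\<And>S :: _ \<Rightarrow> real. measure_pmf.expectation P S = (\<Sum>h=1..H. \<Sum>i=1..I. t h / real I * S (p h i))"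
proof -
  let ?N = "{1..H} \<times> {1..I}" and ?w = "\<lambda>(h, i). t h / real I" and ?p = "\<lambda>(h, i). p h i"
  have "sum ?w ?N = (\<Sum>h=1..H. \<Sum>i=1..I. t h / real I)"
    by (rule sum.cartesian_product[symmetric])
  also have "\<dots> = 1" using I t(2) by simp
  finally have one: "sum ?w ?N = 1" .
  have nonneg: "0 \<le> ?w a" if "a \<in> ?N" for a using t(1) that by auto
  obtain W where W: "set_pmf W \<subseteq> ?N" "\<And>a. a \<in> ?N \<Longrightarrow> pmf W a = ?w a"
    using pmf_with_weights[of ?N ?w, OF _ nonneg one] by blast
  define P where "P = map_pmf ?p W"
  have supp: "set_pmf P \<subseteq> ?p ` ?N" using W(1) by (auto simp: P_def)
  then have sub: "set_pmf P \<subseteq> space (borel_on \<Xi>)" using p by (force simp: space_restrict_space)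
  have "weighted_empirical \<Xi> H I t p = pmf_on (borel_on \<Xi>) P"
  proof (rule measure_eqI)
    fix A assume "A \<in> sets (weighted_empirical \<Xi> H I t p)"
    then have A: "A \<in> sets (borel_on \<Xi>)" by simp
    have "emeasure (pmf_on (borel_on \<Xi>) P) A = (\<integral>\<^sup>+y. indicator A y \<partial>measure_pmf P)"
      unfolding emeasure_pmf_on[OF sub A] by simp
    also have "\<dots> = (\<integral>\<^sup>+a. indicator A (?p a) \<partial>measure_pmf W)"
      unfolding P_def by (rule nn_integral_map_pmf)
    also have "\<dots> = (\<Sum>a\<in>?N. indicator A (?p a) * ennreal (pmf W a))"
      using W(1) by (intro nn_integral_measure_pmf_support) auto
    also have "\<dots> = (\<Sum>(h, i)\<in>?N. indicator A (p h i) * ennreal (t h / real I))"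
      using W(2) by (intro sum.cong) auto
    also have "\<dots> = (\<Sum>h=1..H. \<Sum>i=1..I. indicator A (p h i) * ennreal (t h / real I))"
      by (rule sum.cartesian_product[symmetric])
    also have "\<dots> = emeasure (weighted_empirical \<Xi> H I t p) A"
      unfolding emeasure_weighted_empirical[OF A]
      using A by (intro sum.cong refl) (simp add: sum_distrib_left mult.commute)
    finally show "emeasure (weighted_empirical \<Xi> H I t p) A = emeasure (pmf_on (borel_on \<Xi>) P) A" ..
  qed simp
  moreover have "measure_pmf.expectation P S = (\<Sum>h=1..H. \<Sum>i=1..I. t h / real I * S (p h i))"
    for S :: "_ \<Rightarrow> real"
  proof -
    have "measure_pmf.expectation P S = (\<Sum>a\<in>?N. pmf W a * S (?p a))"
      unfolding P_def using W(1) by (simp, subst integral_measure_pmf[of ?N]) auto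
    also have "\<dots> = (\<Sum>(h, i)\<in>?N. t h / real I * S (p h i))"
      using W(2) by (intro sum.cong) auto
    finally show ?thesis by (simp add: sum.cartesian_product)
  qed
  ultimately show thesis using supp by (intro that)
qed

theorem theorem1:
  fixes X :: "(real ^ 'k) set" and \<Xi> :: "(real ^ 'm) set"
    and nrm :: "real ^ 'm \<Rightarrow> real"
    and H I J :: nat
    and lossj :: "nat \<Rightarrow> real ^ 'k \<Rightarrow> real ^ 'm \<Rightarrow> real"
    and loss :: "real ^ 'k \<Rightarrow> real ^ 'm \<Rightarrow> real"
    and \<xi>h :: "nat \<Rightarrow> nat \<Rightarrow> real ^ 'm"
    and t :: "nat \<Rightarrow> real"
    and \<epsilon> :: real and x :: "real ^ 'k"
  assumes "is_norm nrm"
    and "0 < H" and "0 < I" and "0 < J"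
    and "closed X"
    and "\<And>j. j \<in> {1..J} \<Longrightarrow> (\<lambda>(x, \<xi>). lossj j x \<xi>) \<in> borel_measurable borel"
    and "\<And>x \<xi>. loss x \<xi> = Max ((\<lambda>j. lossj j x \<xi>) ` {1..J})"
    and "\<And>\<xi>. \<xi> \<in> \<Xi> \<Longrightarrow> lsc_on X (\<lambda>x. loss x \<xi>)"
    and "\<And>x. x \<in> X \<Longrightarrow> usc_on \<Xi> (\<lambda>\<xi>. loss x \<xi>)"
    and "\<And>h i. h \<in> {1..H} \<Longrightarrow> i \<in> {1..I} \<Longrightarrow> \<xi>h h i \<in> \<Xi>"
    and "\<And>h. h \<in> {1..H} \<Longrightarrow> t h \<in> {0..1}"
    and "(\<Sum>h=1..H. t h) = 1"
    and "convex \<Xi>" and "closed \<Xi>"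
    and "\<And>x j. x \<in> X \<Longrightarrow> j \<in> {1..J} \<Longrightarrow> proper_fun (\<lambda>\<xi>. ereal (- lossj j x \<xi>))"
    and "\<And>x j. x \<in> X \<Longrightarrow> j \<in> {1..J} \<Longrightarrow> convex_on UNIV (\<lambda>\<xi>. - lossj j x \<xi>)"
    and "\<And>x j. x \<in> X \<Longrightarrow> j \<in> {1..J} \<Longrightarrow> lsc_on UNIV (\<lambda>\<xi>. - lossj j x \<xi>)"
    and "\<And>x j. x \<in> X \<Longrightarrow> j \<in> {1..J} \<Longrightarrow> \<exists>\<xi>\<in>\<Xi>. ereal (lossj j x \<xi>) \<noteq> -\<infinity>"
    and "0 \<le> \<epsilon>" and "x \<in> X"
  shows "(SUP Q\<in>wasserstein_ball nrm \<Xi> \<epsilon> (weighted_empirical \<Xi> H I t \<xi>h). expect Q (loss x)) =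
    (INF (lam, s, z, \<nu>)\<in>program_feasible nrm \<Xi> H I J \<xi>h (\<lambda>j \<xi>. ereal (- lossj j x \<xi>)).
       ereal (lam * \<epsilon> + (\<Sum>h=1..H. \<Sum>i=1..I. t h / real I * s h i)))"
proof -
  define f where "f = loss x"
  have f_Max: "f \<xi> = Max ((\<lambda>j. lossj j x \<xi>) ` {1..J})" for \<xi>
    using assms(7) by (simp add: f_def)
  have f_ge: "lossj j x \<xi> \<le> f \<xi>" if "j \<in> {1..J}" for j \<xi>
    unfolding f_Max using that by (intro Max_ge) auto
  have f_le: "f \<xi> \<le> u" if "\<And>j. j \<in> {1..J} \<Longrightarrow> lossj j x \<xi> \<le> u" for \<xi> u
    unfolding f_Max using that \<open>0 < J\<close> by (subst Max_le_iff) auto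
  have "(\<lambda>\<xi>. lossj j x \<xi>) \<in> borel_measurable borel" if "j \<in> {1..J}" for j
  proof -
    have "(\<lambda>\<xi>. (x, \<xi>)) \<in> borel \<rightarrow>\<^sub>M borel"
      by (intro borel_measurable_continuous_onI continuous_intros)
    from measurable_compose[OF this assms(6)[OF that]] show ?thesis by simp
  qed
  then have f_meas: "f \<in> borel_measurable borel"
    unfolding f_Max[abs_def] by (intro borel_measurable_Max) auto
  note nrm = assms(1)
  have conc: "convex_on UNIV (\<lambda>\<xi>. - lossj j x \<xi>)" if "j \<in> {1..J}" for j
    using assms(16) that \<open>x \<in> X\<close> by blast
  have sample: "\<xi>h h i \<in> \<Xi>" if "h \<in> {1..H}" "i \<in> {1..I}" for h i using assms(10) that .
  have \<Xi>_ne: "\<Xi> \<noteq> {}" using sample[of 1 1] \<open>0 < H\<close> \<open>0 < I\<close> by auto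
  have t: "0 \<le> t h" if "h \<in> {1..H}" for h using assms(11)[OF that] by simp
  obtain P where P: "set_pmf P \<subseteq> (\<lambda>(h, i). \<xi>h h i) ` ({1..H} \<times> {1..I})"
      "weighted_empirical \<Xi> H I t \<xi>h = pmf_on (borel_on \<Xi>) P"
      "\<And>S :: _ \<Rightarrow> real. measure_pmf.expectation P S
         = (\<Sum>h=1..H. \<Sum>i=1..I. t h / real I * S (\<xi>h h i))"
    using weighted_empirical_eq_pmf_on[of H I \<xi>h \<Xi> t, OF sample \<open>0 < I\<close> t assms(12)] by blast
  define D where "D = (\<lambda>(h, i). \<xi>h h i) ` ({1..H} \<times> {1..I})"
  have D: "finite D" "D \<subseteq> \<Xi>" "set_pmf P \<subseteq> D" using P(1) sample by (auto simp: D_def)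
  have P_fin: "finite (set_pmf P)" and P_sub: "set_pmf P \<subseteq> \<Xi>"
    using D finite_subset by auto
  let ?F = "program_feasible nrm \<Xi> H I J \<xi>h (\<lambda>j \<xi>. ereal (- lossj j x \<xi>))"
  let ?obj = "\<lambda>lam s. lam * \<epsilon> + (\<Sum>h=1..H. \<Sum>i=1..I. t h / real I * s h i)"
  let ?sup = "SUP Q\<in>wasserstein_ball nrm \<Xi> \<epsilon> (pmf_on (borel_on \<Xi>) P). expect Q f"
  have feasible: "(lam, s, z, \<nu>) \<in> ?F \<longleftrightarrow>
      (\<forall>h\<in>{1..H}. \<forall>i\<in>{1..I}. \<forall>j\<in>{1..J}. (\<forall>u. \<forall>\<xi>\<in>\<Xi>.
         (z h i j - \<nu> h i j) \<bullet> u - (- lossj j x u) + \<nu> h i j \<bullet> \<xi> - z h i j \<bullet> \<xi>h h i \<le> s h i)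
       \<and> dual_norm nrm (z h i j) \<le> lam)" for lam s z \<nu>
    unfolding program_feasible_def program_constraint_iff[OF \<Xi>_ne] by blast
  have "?sup \<le> (INF (lam, s, z, \<nu>)\<in>?F. ereal (?obj lam s))"
  proof (rule INF_greatest, clarify, rule SUP_least)
    fix lam s z \<nu> Q
    assume F: "(lam, s, z, \<nu>) \<in> ?F"
      and Q: "Q \<in> wasserstein_ball nrm \<Xi> \<epsilon> (pmf_on (borel_on \<Xi>) P)"
    have zb: "z h i j \<bullet> u \<le> lam * nrm u" if "h \<in> {1..H}" "i \<in> {1..I}" "j \<in> {1..J}" for h i j u
      using F that unfolding feasible by (blast intro: inner_le_dual_norm[OF nrm])
    have lam: "0 \<le> lam"
    proof -
      have "dual_norm nrm (z 1 1 1) \<le> lam"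
        using F \<open>0 < H\<close> \<open>0 < I\<close> \<open>0 < J\<close> unfolding feasible by force
      moreover have "nrm 0 \<le> 1" using nrm unfolding is_norm_def by (metis zero_le_one)
      ultimately show ?thesis using dual_norm_le_iff[OF nrm] by (metis inner_zero_right)
    qed
    have bound: "f \<xi> \<le> s h i + lam * nrm (\<xi> - \<xi>h h i)"
      if hi: "h \<in> {1..H}" "i \<in> {1..I}" and \<xi>: "\<xi> \<in> \<Xi>" for h i \<xi>
    proof (rule f_le)
      fix j assume j: "j \<in> {1..J}"
      \<comment> \<open>Evaluating conjugate and support function at the same point \<open>\<xi>\<close> cancels \<open>\<nu>\<close>.\<close>
      have "(z h i j - \<nu> h i j) \<bullet> \<xi> - (- lossj j x \<xi>) + \<nu> h i j \<bullet> \<xi> - z h i j \<bullet> \<xi>h h i \<le> s h i"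
        using F hi j \<xi> unfolding feasible by blast
      then show "lossj j x \<xi> \<le> s h i + lam * nrm (\<xi> - \<xi>h h i)"
        using zb[OF hi j, of "\<xi>h h i - \<xi>"] is_norm_minus_commute[OF nrm, of \<xi> "\<xi>h h i"]
        by (simp add: inner_diff_left inner_diff_right)
    qed
    \<comment> \<open>Indices that share a sample point may carry different values of \<open>s\<close>; the potential takes
      the least one, since each of them gives a valid bound.\<close>
    define S where "S y = Min ((\<lambda>(h, i). s h i) ` {(h, i) \<in> {1..H} \<times> {1..I}. \<xi>h h i = y})" for y
    have finS: "finite {(h, i) \<in> {1..H} \<times> {1..I}. \<xi>h h i = y}" for y
      by (rule finite_subset[of _ "{1..H} \<times> {1..I}"]) auto
    have S_le: "S (\<xi>h h i) \<le> s h i" if "h \<in> {1..H}" "i \<in> {1..I}" for h i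
      unfolding S_def using that finS by (intro Min_le) auto
    have S_bound: "f \<xi> \<le> S y + lam * nrm (\<xi> - y)"
      if y: "y \<in> set_pmf P" and \<xi>: "\<xi> \<in> \<Xi>" for y \<xi>
    proof -
      obtain a where "a \<in> {1..H} \<times> {1..I}" "y = (\<lambda>(h, i). \<xi>h h i) a"
        using y P(1) by blast
      then have "a \<in> {(h, i) \<in> {1..H} \<times> {1..I}. \<xi>h h i = y}" by auto
      then have "S y \<in> (\<lambda>(h, i). s h i) ` {(h, i) \<in> {1..H} \<times> {1..I}. \<xi>h h i = y}"
        unfolding S_def by (intro Min_in finite_imageI finS) blast
      then obtain h i where "h \<in> {1..H}" "i \<in> {1..I}" "\<xi>h h i = y" "S y = s h i" by auto
      then show ?thesis using bound[of h i \<xi>] \<xi> by simp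
    qed
    have "expect Q f \<le> ereal (lam * \<epsilon> + measure_pmf.expectation P S)"
      by (rule weak_duality[OF nrm f_meas P_fin P_sub lam \<open>0 \<le> \<epsilon>\<close> S_bound Q])
    also have "lam * \<epsilon> + measure_pmf.expectation P S \<le> ?obj lam s"
      unfolding P(3) using S_le t by (intro add_left_mono sum_mono mult_left_mono) auto
    finally show "expect Q f \<le> ereal (?obj lam s)" by simp
  qed
  moreover have "(INF (lam, s, z, \<nu>)\<in>?F. ereal (?obj lam s)) \<le> ?sup"
  proof (cases "?sup = \<infinity>")
    case False
    define \<pi>0 where "\<pi>0 = map_pmf (\<lambda>y. (y, y)) P"
    have "\<pi>0 \<in> finite_plans \<Xi> P"
      using transport_map_plan[OF P_fin P_sub, of "\<lambda>y. y"] P_sub by (auto simp: \<pi>0_def)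
    moreover have "nrm 0 = 0" using nrm unfolding is_norm_def by blast
    then have "measure_pmf.expectation \<pi>0 (\<lambda>z. nrm (fst z - snd z)) \<le> \<epsilon>"
      using \<open>0 \<le> \<epsilon>\<close> by (simp add: \<pi>0_def)
    ultimately have "?sup \<noteq> - \<infinity>"
      using finite_plan_expect_le_SUP[OF nrm f_meas, of \<pi>0 \<Xi> P \<epsilon>] by auto
    then obtain v where v: "?sup = ereal v" using False by (cases ?sup) auto
    have lip: "\<exists>L\<ge>0. \<forall>\<xi>\<in>\<Xi>. f \<xi> \<le> f y + L * nrm (\<xi> - y)" for y
    proof -
      have "\<exists>L\<ge>0. \<forall>\<xi>. lossj j x \<xi> \<le> lossj j x y + L * nrm (\<xi> - y)" if "j \<in> {1..J}" for j
        using concave_Lipschitz_above[OF nrm conc[OF that], of y] by metis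
      then obtain L where L: "\<And>j. j \<in> {1..J} \<Longrightarrow> 0 \<le> L j"
          "\<And>j \<xi>. j \<in> {1..J} \<Longrightarrow> lossj j x \<xi> \<le> lossj j x y + L j * nrm (\<xi> - y)"
        by metis
      have "f \<xi> \<le> f y + sum L {1..J} * nrm (\<xi> - y)" for \<xi>
      proof (rule f_le)
        fix j assume j: "j \<in> {1..J}"
        have "L j * nrm (\<xi> - y) \<le> sum L {1..J} * nrm (\<xi> - y)"
          using nrm j L(1) by (intro mult_right_mono member_le_sum) (auto simp: is_norm_def)
        then show "lossj j x \<xi> \<le> f y + sum L {1..J} * nrm (\<xi> - y)"
          using L(2)[OF j, of \<xi>] f_ge[OF j, of y] by linarith
      qed
      then show ?thesis using L(1) by (intro exI[of _ "sum L {1..J}"]) (auto intro: sum_nonneg)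
    qed
    have plan_le: "measure_pmf.expectation \<pi> (\<lambda>z. f (fst z)) \<le> v"
      if "\<pi> \<in> finite_plans \<Xi> P" "measure_pmf.expectation \<pi> (\<lambda>z. nrm (fst z - snd z)) \<le> \<epsilon>" for \<pi>
      using finite_plan_expect_le_SUP[OF nrm f_meas that] unfolding v by simp
    obtain lam S where lam: "0 \<le> lam"
        and S: "\<And>y \<xi>. y \<in> D \<Longrightarrow> \<xi> \<in> \<Xi> \<Longrightarrow> f \<xi> \<le> S y + lam * nrm (\<xi> - y)"
        and val: "lam * \<epsilon> + measure_pmf.expectation P S \<le> v"
      using dual_potential_exists[of nrm P \<Xi> \<epsilon> D f v, OF nrm P_fin P_sub \<open>0 \<le> \<epsilon>\<close> D lip plan_le]
      by blast
    define cert where "cert h i j z \<nu> \<longleftrightarrow> dual_norm nrm z \<le> lam \<and> (\<forall>u. \<forall>\<xi>\<in>\<Xi>.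
        (z - \<nu>) \<bullet> u - (- lossj j x u) + \<nu> \<bullet> \<xi> - z \<bullet> \<xi>h h i \<le> S (\<xi>h h i))"
      for h i j z \<nu>
    have "\<exists>z \<nu>. cert h i j z \<nu>"
      if hi: "h \<in> {1..H}" "i \<in> {1..I}" and j: "j \<in> {1..J}" for h i j
    proof -
      have D: "\<xi>h h i \<in> D" unfolding D_def using hi by (intro image_eqI[of _ _ "(h, i)"]) auto
      have le: "lossj j x \<xi> \<le> S (\<xi>h h i) + lam * nrm (\<xi> - \<xi>h h i)" if "\<xi> \<in> \<Xi>" for \<xi>
        using S[OF D that] f_ge[OF j, of \<xi>] by linarith
      show ?thesis
      proof (rule dual_certificate[OF nrm conc[OF j] \<open>convex \<Xi>\<close> \<Xi>_ne lam le])
        fix z \<nu>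
        assume "dual_norm nrm z \<le> lam"
          "\<And>u \<xi>. \<xi> \<in> \<Xi> \<Longrightarrow> (z - \<nu>) \<bullet> u - (- lossj j x u) + \<nu> \<bullet> \<xi> - z \<bullet> \<xi>h h i \<le> S (\<xi>h h i)"
        then have "cert h i j z \<nu>" unfolding cert_def by blast
        then show ?thesis by blast
      qed
    qed
    then obtain z \<nu> where "\<And>h i j. h \<in> {1..H} \<Longrightarrow> i \<in> {1..I} \<Longrightarrow> j \<in> {1..J} \<Longrightarrow>
        cert h i j (z h i j) (\<nu> h i j)"
      by metis
    then have "(lam, \<lambda>h i. S (\<xi>h h i), z, \<nu>) \<in> ?F" unfolding feasible cert_def by blast
    then have "(INF (lam, s, z, \<nu>)\<in>?F. ereal (?obj lam s)) \<le> ereal (?obj lam (\<lambda>h i. S (\<xi>h h i)))"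
      by (rule INF_lower2) simp
    also have "\<dots> \<le> ?sup" using val unfolding v P(3) by simp
    finally show ?thesis .
  qed simp
  ultimately show ?thesis unfolding P(2) f_def by (rule antisym)
qed

end
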